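(* Let $\Theta$ be a nonconstant inner function and let $\varphi \in L^2$. For $\lambda \in \mathbb{D}$ define the measure $$d\nu_{\lambda}(z) := \frac{1-|\lambda|^2}{1-|\Theta(\lambda)|^2}\left|\frac{\Theta(z)-\Theta(\lambda)}{z-\lambda}\right|^2\frac{|dz|}{2\pi}$$ on $\partial\mathbb{D}$. Then each $\nu_\lambda$, $\lambda\in\mathbb{D}$, is a probability measure on $\partial\mathbb{D}$, and $$\sup_{\lambda\in\mathbb{D}}\left|\int_{\partial\mathbb{D}}\varphi(z)\,d\nu_\lambda(z)\right| = \sup_{\lambda\in\mathbb{D}}\frac{1-|\lambda|^2}{1-|\Theta(\lambda)|^2}\left|\int_{\partial\mathbb{D}}\varphi(z)\left|\frac{\Theta(z)-\Theta(\lambda)}{z-\lambda}\right|^2\frac{|dz|}{2\pi}\right| \leq \|A_\varphi\|.$$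
   Context: $\mathbb{D}$ is the open unit disk, $\partial\mathbb{D}$ the unit circle, $L^2 = L^2(\partial\mathbb{D},\frac{|d\zeta|}{2\pi})$ (complex-valued) with norm $\|\cdot\|$. $H^2$ is the Hardy space of $\mathbb{D}$, regarded as a closed subspace of $L^2$ via non-tangential boundary values, and $H^\infty$ is the set of bounded analytic functions on $\mathbb{D}$. An inner function $\Theta$ is an element of $H^\infty$ with $|\Theta|=1$ a.e. on $\partial\mathbb{D}$; for $z\in\partial\mathbb{D}$, $\Theta(z)$ denotes the boundary value. The model space is $K_\Theta := H^2\cap(\Theta H^2)^\perp$, $P_\Theta$ is the orthogonal projection of $L^2$ onto $K_\Theta$, and $K_\Theta^\infty := H^\infty\cap K_\Theta$, which is dense in $K_\Theta$. For $\varphi\in L^2$ the truncated Toeplitz operator is the densely defined operator $A_\varphi f := P_\Theta(\varphi f)$, $f\in K_\Theta^\infty$, and $\|A_\varphi\| := \sup\{\|A_\varphi f\| : f\in K_\Theta^\infty,\ \|f\|=1\}\in[0,\infty]$. *)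

theory Defs
  imports "HOL-Complex_Analysis.Complex_Analysis" "HOL-Probability.Probability"
begin

text \<open>Normalised arc length on the unit circle. The underlying space is the circle itself.\<close>

definition circle_measure :: "complex measure" where
  "circle_measure =
     distr (uniform_measure lborel {0..<2 * pi}) (restrict_space borel (sphere 0 1)) cis"

text \<open>
  Elements of \<open>L\<^sup>2\<close> are represented by functions rather than by classes of a.e. equal functions;
  the values off the circle are irrelevant, and all subspaces below are closed under
  a.e. modification (within the measurable functions).
\<close>

definition L2_circle :: "(complex \<Rightarrow> complex) set" where
  "L2_circle = {f \<in> borel_measurable circle_measure.
     integrable circle_measure (\<lambda>z. (cmod (f z))\<^sup>2)}"

definition l2_inner :: "(complex \<Rightarrow> complex) \<Rightarrow> (complex \<Rightarrow> complex) \<Rightarrow> complex" where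
  "l2_inner f g = (\<integral>z. f z * cnj (g z) \<partial>circle_measure)"

definition l2_norm :: "(complex \<Rightarrow> complex) \<Rightarrow> real" where
  "l2_norm f = sqrt (\<integral>z. (cmod (f z))\<^sup>2 \<partial>circle_measure)"

definition stolz_region :: "real \<Rightarrow> complex \<Rightarrow> complex set" where
  "stolz_region \<alpha> \<zeta> = {z \<in> ball 0 1. cmod (z - \<zeta>) < \<alpha> * (1 - cmod z)}"

definition nt_limit :: "(complex \<Rightarrow> complex) \<Rightarrow> complex \<Rightarrow> complex \<Rightarrow> bool" where
  "nt_limit F \<zeta> l \<longleftrightarrow> (\<forall>\<alpha>>1. (F \<longlongrightarrow> l) (at \<zeta> within stolz_region \<alpha> \<zeta>))"

text \<open>Meaningful only at points where the non-tangential limit exists.\<close>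

definition boundary_value :: "(complex \<Rightarrow> complex) \<Rightarrow> complex \<Rightarrow> complex" where
  "boundary_value F \<zeta> = (THE l. nt_limit F \<zeta> l)"

definition H2_disc :: "(complex \<Rightarrow> complex) set" where
  "H2_disc = {F. F holomorphic_on ball 0 1 \<and>
     bdd_above ((\<lambda>r. \<integral>z. (cmod (F (of_real r * z)))\<^sup>2 \<partial>circle_measure) ` {0..<1})}"

definition Hinf_disc :: "(complex \<Rightarrow> complex) set" where
  "Hinf_disc = {F. F holomorphic_on ball 0 1 \<and> bounded (F ` ball 0 1)}"

text \<open>The Hardy classes as classes of functions on the circle.\<close>

definition H2_circle :: "(complex \<Rightarrow> complex) set" where
  "H2_circle = {f \<in> L2_circle. \<exists>F \<in> H2_disc. AE z in circle_measure. nt_limit F z (f z)}"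

definition Hinf_circle :: "(complex \<Rightarrow> complex) set" where
  "Hinf_circle = {f \<in> L2_circle. \<exists>F \<in> Hinf_disc. AE z in circle_measure. nt_limit F z (f z)}"

definition inner_function :: "(complex \<Rightarrow> complex) \<Rightarrow> bool" where
  "inner_function \<Theta> \<longleftrightarrow> \<Theta> \<in> Hinf_disc \<and>
     (AE z in circle_measure. \<exists>l. nt_limit \<Theta> z l \<and> cmod l = 1)"

definition model_space :: "(complex \<Rightarrow> complex) \<Rightarrow> (complex \<Rightarrow> complex) set" where
  "model_space \<Theta> = {f \<in> H2_circle.
     \<forall>g \<in> H2_circle. l2_inner f (\<lambda>z. boundary_value \<Theta> z * g z) = 0}"

definition model_space_inf :: "(complex \<Rightarrow> complex) \<Rightarrow> (complex \<Rightarrow> complex) set" where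
  "model_space_inf \<Theta> = Hinf_circle \<inter> model_space \<Theta>"

text \<open>
  The orthogonal projection onto the model space; it is determined only up to a.e. equality,
  so a representative is chosen.
\<close>

definition model_projection ::
    "(complex \<Rightarrow> complex) \<Rightarrow> (complex \<Rightarrow> complex) \<Rightarrow> complex \<Rightarrow> complex" where
  "model_projection \<Theta> f = (SOME g. g \<in> model_space \<Theta> \<and>
     (\<forall>h \<in> model_space \<Theta>. l2_inner (\<lambda>z. f z - g z) h = 0))"

definition truncated_toeplitz ::
    "(complex \<Rightarrow> complex) \<Rightarrow> (complex \<Rightarrow> complex) \<Rightarrow> (complex \<Rightarrow> complex) \<Rightarrow> complex \<Rightarrow> complex"
  where
  "truncated_toeplitz \<Theta> \<phi> f = model_projection \<Theta> (\<lambda>z. \<phi> z * f z)"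

definition truncated_toeplitz_norm ::
    "(complex \<Rightarrow> complex) \<Rightarrow> (complex \<Rightarrow> complex) \<Rightarrow> ennreal" where
  "truncated_toeplitz_norm \<Theta> \<phi> =
     (SUP f \<in> {f \<in> model_space_inf \<Theta>. l2_norm f = 1}.
        ennreal (l2_norm (truncated_toeplitz \<Theta> \<phi> f)))"

definition nu_measure :: "(complex \<Rightarrow> complex) \<Rightarrow> complex \<Rightarrow> complex measure" where
  "nu_measure \<Theta> w = density circle_measure (\<lambda>z. ennreal
     ((1 - (cmod w)\<^sup>2) / (1 - (cmod (\<Theta> w))\<^sup>2) *
      (cmod ((boundary_value \<Theta> z - \<Theta> w) / (z - w)))\<^sup>2))"

end

theory Submission
  imports Defs
begin

text \<open>
  For \<open>w\<close> in the disc let \<open>k\<^sub>w(t) = (1 - cnj (\<Theta> w) * \<Theta> t) / (1 - cnj w * t)\<close> be the reproducing kernel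
  of the model space. On the circle \<open>\<bar>k\<^sub>w t\<bar> = \<bar>\<Theta> t - \<Theta> w\<bar> / \<bar>t - w\<bar>\<close>, and
  \<open>\<parallel>k\<^sub>w\<parallel>\<^sup>2 = (1 - \<bar>\<Theta> w\<bar>\<^sup>2) / (1 - \<bar>w\<bar>\<^sup>2)\<close>. So the integral of \<open>\<phi>\<close> against \<open>\<nu>\<^sub>w\<close> is
  \<open>\<langle>A\<^sub>\<phi> f, f\<rangle>\<close> for the unit vector \<open>f = k\<^sub>w / \<parallel>k\<^sub>w\<parallel>\<close>, and Cauchy-Schwarz applies.

  That the projection onto the model space exists rests on Fatou's theorem: a power series with
  square-summable coefficients has non-tangential limits a.e. This follows from a weak-type maximal
  inequality, which needs no covering argument: if \<open>A\<^sub>i\<close> are disjoint sets of measure \<open>m\<^sub>i\<close>, each in the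
  shadow of a point \<open>z\<^sub>i\<close>, then the inner products of Poisson kernels satisfy
  \<open>\<langle>P\<^sub>z, P\<^sub>w\<rangle> \<le> C (P\<^sub>z(t) + P\<^sub>w(s))\<close> for \<open>t\<close> in the shadow of \<open>w\<close> and \<open>s\<close> in that of \<open>z\<close>, so
  \<open>\<parallel>\<Sum>\<^sub>i m\<^sub>i P(z\<^sub>i)\<parallel>\<^sup>2 \<le> 2 C \<Sum>\<^sub>i m\<^sub>i\<close>.
\<close>

section \<open>The circle and its square-integrable functions\<close>

lemma space_circle_measure [simp]: "space circle_measure = sphere 0 1"
  by (simp add: circle_measure_def)

lemma sets_circle_measure [measurable_cong]:
  "sets circle_measure = sets (restrict_space borel (sphere 0 1))"
  by (simp add: circle_measure_def)

lemma measurable_cis_circle: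
  "cis \<in> measurable (uniform_measure lborel {0..<2 * pi}) (restrict_space borel (sphere 0 1))"
  by (rule measurable_restrict_space2)
     (auto simp: cong: measurable_cong_sets intro!: borel_measurable_continuous_onI continuous_intros)

interpretation circle: prob_space circle_measure
  unfolding circle_measure_def
  by (intro prob_space.prob_space_distr prob_space_uniform_measure measurable_cis_circle) auto

lemma measure_circle_sphere [simp]: "measure circle_measure (sphere 0 1) = 1"
  using circle.prob_space by simp

lemma borel_measurable_circleI:
  "continuous_on (sphere 0 1) f \<Longrightarrow> f \<in> borel_measurable circle_measure"
  by (subst measurable_cong_sets[OF sets_circle_measure refl])
     (rule borel_measurable_continuous_on_restrict)

lemma borel_imp_measurable_circle:
  "f \<in> borel_measurable borel \<Longrightarrow> f \<in> borel_measurable circle_measure"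
  by (subst measurable_cong_sets[OF sets_circle_measure refl]) (rule measurable_restrict_space1)

lemma ident_measurable_circle [measurable]: "(\<lambda>z. z) \<in> borel_measurable circle_measure"
  by (intro borel_imp_measurable_circle) simp

lemma open_Int_sphere_sets_circle:
  "open S \<Longrightarrow> S \<inter> sphere 0 1 \<in> sets circle_measure"
  unfolding sets_circle_measure sets_restrict_space by (simp add: Int_commute)

text \<open>Passes to the closed interval, the form in which the fundamental theorem of calculus is
  applied; the added endpoint \<open>2*pi\<close> is a null set.\<close>

lemma integral_circle_cis:
  fixes f :: "complex \<Rightarrow> complex"
  assumes "continuous_on (sphere 0 1) f"
  shows "(\<integral>z. f z \<partial>circle_measure) = (\<integral>t. indicator {0..2*pi} t *\<^sub>R f (cis t) \<partial>lborel) / (2 * pi)"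
proof -
  let ?I = "{0..<2*pi}"
  have [measurable]: "f \<in> borel_measurable (restrict_space borel (sphere 0 1))"
    by (rule borel_measurable_continuous_on_restrict[OF assms])
  have "continuous_on UNIV (f \<circ> cis)"
    by (rule continuous_on_compose) (auto intro!: continuous_intros continuous_on_subset[OF assms])
  then have [measurable]: "(\<lambda>t. f (cis t)) \<in> borel_measurable borel"
    by (auto dest: borel_measurable_continuous_onI simp: o_def)
  have u: "uniform_measure lborel ?I = density lborel (\<lambda>t. ennreal (indicator ?I t / (2*pi)))"
    unfolding uniform_measure_def
    by (intro density_cong)
       (auto simp: indicator_def divide_ennreal ennreal_1[symmetric] simp del: ennreal_1)
  have "(\<integral>z. f z \<partial>circle_measure) = (\<integral>t. f (cis t) \<partial>uniform_measure lborel ?I)"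
    unfolding circle_measure_def by (rule integral_distr[OF measurable_cis_circle]) measurable
  also have "\<dots> = (\<integral>t. (indicator ?I t / (2*pi)) *\<^sub>R f (cis t) \<partial>lborel)"
    unfolding u by (rule integral_density) auto
  also have "\<dots> = (\<integral>t. (indicator {0..2*pi} t *\<^sub>R f (cis t)) / (2 * pi) \<partial>lborel)"
  proof (rule integral_cong_AE)
    have "AE t in lborel. t \<noteq> 2*pi" by (rule AE_lborel_singleton)
    then show "AE t in lborel. (indicator ?I t / (2*pi)) *\<^sub>R f (cis t) =
        (indicator {0..2*pi} t *\<^sub>R f (cis t)) / (2 * pi)"
      by eventually_elim (auto simp: indicator_def scaleR_conv_of_real)
  qed auto
  also have "\<dots> = (\<integral>t. (indicator {0..2*pi} t *\<^sub>R f (cis t)) \<partial>lborel) / (2 * pi)"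
    by (rule integral_divide_zero)
  finally show ?thesis .
qed

text \<open>For \<open>n > 0\<close> the pullback of the power along \<open>cis\<close> has the
  \<open>2*pi\<close>-periodic primitive \<open>?F\<close>, so its integral over a full period
  vanishes.\<close>

lemma integral_circle_power:
  "(\<integral>z. z ^ n \<partial>circle_measure) = (if n = 0 then 1 else 0)"
proof (cases "n = 0")
  case True
  then show ?thesis by simp
next
  case False
  let ?F = "\<lambda>t::real. cis (real n * t) / (\<i> * n)"
  have "(\<integral>t. indicator {0..2*pi} t *\<^sub>R (cis t)^n \<partial>lborel) = ?F (2*pi) - ?F 0"
  proof (rule integral_FTC_Icc)
    show "(?F has_vector_derivative (cis t)^n) (at t within {0..2*pi})" for t
    proof -
      have "((\<lambda>z. exp (\<i> * (n * z)) / (\<i> * n)) has_field_derivative exp (\<i> * (n * of_real t)))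
          (at (of_real t))"
        using False by (auto intro!: derivative_eq_intros simp: field_simps)
      from has_vector_derivative_real_field[OF this] show ?thesis
        by (simp add: cis_conv_exp exp_of_nat_mult[symmetric] mult_ac)
    qed
    show "continuous_on {0..2*pi} (\<lambda>t. cis t ^ n)" by (intro continuous_intros)
  qed auto
  also have "\<dots> = 0"
    using cis_multiple_2pi[of "of_nat n"] by (simp add: mult_ac)
  finally show ?thesis using False
    by (subst integral_circle_cis) (auto intro!: continuous_intros)
qed

lemma integral_circle_cnj:
  "(\<integral>z. cnj (f z) \<partial>circle_measure) = cnj (\<integral>z. f z \<partial>circle_measure)"
  by simp

lemma circle_norm_power: "cmod z = 1 \<Longrightarrow> z ^ n * cnj z ^ n = 1"
  by (metis complex_norm_square mult.commute of_real_1 one_power2 power_mult_distrib power_one)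

text \<open>On the circle \<open>cnj z\<close> is the inverse of \<open>z\<close>, so the integrand
  collapses to a single power when \<open>n \<le> m\<close>; the other case is the conjugate of this
  one.\<close>

lemma circle_orthonormal:
  "(\<integral>z. z ^ m * cnj z ^ n \<partial>circle_measure) = (if m = n then 1 else 0)"
proof -
  have *: "(\<integral>z. z ^ (n + k) * cnj z ^ n \<partial>circle_measure) = (if k = 0 then 1 else 0)" for n k
  proof -
    have "(\<integral>z. z ^ (n + k) * cnj z ^ n \<partial>circle_measure) = (\<integral>z. z ^ k \<partial>circle_measure)"
      by (rule Bochner_Integration.integral_cong)
         (simp_all add: power_add mult.assoc mult.left_commute[of "_ ^ n"] circle_norm_power)
    then show ?thesis by (simp add: integral_circle_power)
  qed
  show ?thesis
  proof (cases "n \<le> m")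
    case True
    then show ?thesis using *[of n "m - n"] by simp
  next
    case False
    then have "(\<integral>z. cnj (z ^ n * cnj z ^ m) \<partial>circle_measure) = 0"
      using *[of m "n - m"] by (subst integral_circle_cnj) simp
    then show ?thesis using False by (simp add: mult.commute)
  qed
qed

section \<open>Square integrability, inner product and norm\<close>

lemma L2_circleD [measurable_dest]: "f \<in> L2_circle \<Longrightarrow> f \<in> borel_measurable circle_measure"
  by (simp add: L2_circle_def)

lemma L2_circle_integrable_sq: "f \<in> L2_circle \<Longrightarrow> integrable circle_measure (\<lambda>z. (cmod (f z))\<^sup>2)"
  by (simp add: L2_circle_def)

lemma L2_circle_mult_integrable:
  assumes "f \<in> L2_circle" "g \<in> L2_circle"
  shows "integrable circle_measure (\<lambda>z. f z * g z)"
proof (rule Bochner_Integration.integrable_bound)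
  show "integrable circle_measure (\<lambda>z. (cmod (f z))\<^sup>2 + (cmod (g z))\<^sup>2)"
    using assms by (intro Bochner_Integration.integrable_add L2_circle_integrable_sq)
  have "2 * (x * y) \<le> x\<^sup>2 + y\<^sup>2" for x y :: real
    using sum_squares_bound[of x y] by simp
  moreover have "0 \<le> cmod (f z) * cmod (g z)" for z by simp
  ultimately show "AE z in circle_measure. norm (f z * g z) \<le> norm ((cmod (f z))\<^sup>2 + (cmod (g z))\<^sup>2)"
    by (intro AE_I2) (smt (verit, best) norm_mult real_norm_def)
qed (use assms in measurable)

lemma L2_circle_cnj: "f \<in> L2_circle \<Longrightarrow> (\<lambda>z. cnj (f z)) \<in> L2_circle"
  by (auto simp: L2_circle_def intro!: borel_measurable_continuous_on[of cnj] continuous_intros)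

lemma L2_circle_bounded_mult:
  assumes "f \<in> L2_circle" and [measurable]: "g \<in> borel_measurable circle_measure"
    and "AE z in circle_measure. cmod (g z) \<le> B"
  shows "(\<lambda>z. g z * f z) \<in> L2_circle"
proof -
  have "integrable circle_measure (\<lambda>z. (cmod (g z * f z))\<^sup>2)"
  proof (rule Bochner_Integration.integrable_bound)
    show "integrable circle_measure (\<lambda>z. B\<^sup>2 * (cmod (f z))\<^sup>2)"
      using assms(1) by (intro integrable_mult_right L2_circle_integrable_sq)
    show "AE z in circle_measure. norm ((cmod (g z * f z))\<^sup>2) \<le> norm (B\<^sup>2 * (cmod (f z))\<^sup>2)"
      using assms(3)
      by eventually_elim (auto simp: norm_mult power_mult_distrib intro!: mult_right_mono power_mono)
  qed (use assms in measurable)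
  then show ?thesis using assms by (auto simp: L2_circle_def)
qed

lemma L2_circle_const: "(\<lambda>z. c) \<in> L2_circle"
  by (simp add: L2_circle_def)

lemma L2_circle_bounded:
  assumes "g \<in> borel_measurable circle_measure" "AE z in circle_measure. cmod (g z) \<le> B"
  shows "g \<in> L2_circle"
  using L2_circle_bounded_mult[OF L2_circle_const[of 1] assms] by simp

lemma L2_circle_continuous:
  assumes "continuous_on (sphere 0 1) g"
  shows "g \<in> L2_circle"
proof -
  have "compact (g ` sphere 0 1)" by (rule compact_continuous_image[OF assms]) simp
  then obtain B where "\<forall>x\<in>g ` sphere 0 1. cmod x \<le> B"
    using compact_imp_bounded bounded_iff by blast
  then show ?thesis
    by (intro L2_circle_bounded[of _ B] borel_measurable_circleI assms AE_I2) auto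
qed

lemma L2_circle_mult: "f \<in> L2_circle \<Longrightarrow> (\<lambda>z. c * f z) \<in> L2_circle"
  by (rule L2_circle_bounded_mult[where B = "cmod c"]) auto

lemma L2_circle_add:
  assumes "f \<in> L2_circle" "g \<in> L2_circle"
  shows "(\<lambda>z. f z + g z) \<in> L2_circle"
proof -
  have "integrable circle_measure (\<lambda>z. (cmod (f z + g z))\<^sup>2)"
  proof (rule Bochner_Integration.integrable_bound)
    show "integrable circle_measure (\<lambda>z. 2 * ((cmod (f z))\<^sup>2 + (cmod (g z))\<^sup>2))"
      using assms by (intro integrable_mult_right Bochner_Integration.integrable_add L2_circle_integrable_sq)
    have "(cmod (x + y))\<^sup>2 \<le> 2 * ((cmod x)\<^sup>2 + (cmod y)\<^sup>2)" for x y
    proof -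
      have "(cmod (x + y))\<^sup>2 \<le> (cmod x + cmod y)\<^sup>2"
        by (intro power_mono norm_triangle_ineq) auto
      also have "\<dots> \<le> 2 * ((cmod x)\<^sup>2 + (cmod y)\<^sup>2)"
        using sum_squares_bound[of "cmod x" "cmod y"] by (simp add: power2_sum)
      finally show ?thesis .
    qed
    then show "AE z in circle_measure. norm ((cmod (f z + g z))\<^sup>2) \<le>
        norm (2 * ((cmod (f z))\<^sup>2 + (cmod (g z))\<^sup>2))" by auto
  qed (use assms in measurable)
  then show ?thesis using assms by (auto simp: L2_circle_def)
qed

lemma L2_circle_diff:
  assumes "f \<in> L2_circle" "g \<in> L2_circle"
  shows "(\<lambda>z. f z - g z) \<in> L2_circle"
  using L2_circle_add[OF assms(1) L2_circle_mult[OF assms(2), of "-1"]] by simp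

lemma l2_inner_integrable:
  "f \<in> L2_circle \<Longrightarrow> g \<in> L2_circle \<Longrightarrow> integrable circle_measure (\<lambda>z. f z * cnj (g z))"
  by (intro L2_circle_mult_integrable L2_circle_cnj)

lemma l2_inner_diff_left:
  "\<lbrakk>f \<in> L2_circle; g \<in> L2_circle; h \<in> L2_circle\<rbrakk> \<Longrightarrow>
    l2_inner (\<lambda>z. f z - g z) h = l2_inner f h - l2_inner g h"
  unfolding l2_inner_def
  by (simp add: left_diff_distrib Bochner_Integration.integral_diff l2_inner_integrable)

lemma l2_inner_commute: "l2_inner f g = cnj (l2_inner g f)"
  unfolding l2_inner_def by (subst integral_circle_cnj[symmetric]) (simp add: mult.commute)

lemma l2_inner_diff_right:
  "\<lbrakk>f \<in> L2_circle; g \<in> L2_circle; h \<in> L2_circle\<rbrakk> \<Longrightarrow>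
    l2_inner h (\<lambda>z. f z - g z) = l2_inner h f - l2_inner h g"
  by (subst (1 2 3) l2_inner_commute) (simp add: l2_inner_diff_left)

lemma l2_inner_mult_left: "l2_inner (\<lambda>z. c * f z) g = c * l2_inner f g"
  unfolding l2_inner_def by (simp add: mult.assoc)

lemma l2_inner_mult_right: "l2_inner f (\<lambda>z. c * g z) = cnj c * l2_inner f g"
  unfolding l2_inner_def by (simp add: mult.left_commute)

lemma l2_inner_self: "l2_inner f f = of_real ((l2_norm f)\<^sup>2)"
  unfolding l2_inner_def l2_norm_def
  by (simp add: complex_norm_square[symmetric] flip: of_real_power)

lemma l2_norm_nonneg [simp]: "0 \<le> l2_norm f"
  by (simp add: l2_norm_def)

lemma l2_norm_sq: "(l2_norm f)\<^sup>2 = (\<integral>z. (cmod (f z))\<^sup>2 \<partial>circle_measure)"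
  by (simp add: l2_norm_def)

text \<open>Integrates \<open>(s * ?F z - t * ?G z)^2 \<ge> 0\<close> for arbitrary real
  \<open>s\<close> and \<open>t\<close>. The moduli stay inside the integral because the maximal
  estimate pairs the modulus of a polynomial with a sum of Poisson kernels.\<close>

lemma l2_cauchy_schwarz:
  assumes "f \<in> L2_circle" "g \<in> L2_circle"
  shows "(\<integral>z. cmod (f z) * cmod (g z) \<partial>circle_measure) \<le> l2_norm f * l2_norm g"
proof -
  let ?F = "\<lambda>z. cmod (f z)" and ?G = "\<lambda>z. cmod (g z)"
  let ?P = "\<integral>z. ?F z * ?G z \<partial>circle_measure"
  have i: "integrable circle_measure (\<lambda>z. ?F z * ?G z)"
    using integrable_norm[OF L2_circle_mult_integrable[OF assms]] by (simp add: norm_mult)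
  note i2 = L2_circle_integrable_sq[OF assms(1)] L2_circle_integrable_sq[OF assms(2)]
  have q: "2 * (s * t) * ?P \<le> s\<^sup>2 * (l2_norm f)\<^sup>2 + t\<^sup>2 * (l2_norm g)\<^sup>2" for s t
  proof -
    have "0 \<le> (\<integral>z. (s * ?F z - t * ?G z)\<^sup>2 \<partial>circle_measure)" by simp
    also have "\<dots> = (\<integral>z. s\<^sup>2 * (?F z)\<^sup>2 + t\<^sup>2 * (?G z)\<^sup>2 - 2 * (s * t) * (?F z * ?G z) \<partial>circle_measure)"
      by (intro Bochner_Integration.integral_cong) (auto simp: power2_eq_square algebra_simps)
    also have "\<dots> = s\<^sup>2 * (l2_norm f)\<^sup>2 + t\<^sup>2 * (l2_norm g)\<^sup>2 - 2 * (s * t) * ?P"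
      using i i2 by (simp add: l2_norm_sq)
    finally show ?thesis by simp
  qed
  let ?a = "l2_norm f" and ?b = "l2_norm g"
  \<comment> \<open>Handles a vanishing norm: \<open>q\<close> then bounds a linear function of one
    parameter by a constant, which forces slope zero. The witness \<open>(c^2 + 1) / P\<close> turns
    the bound into \<open>2 * (c^2 + 1) \<le> c\<close>, which is impossible.\<close>
  have nonpos: "P \<le> 0" if "\<And>x. 2 * x * P \<le> c" for P c :: real
    using that[of "(c\<^sup>2 + 1) / P"] that[of 0] sum_squares_bound[of c 1] zero_le_square[of c]
    by (cases "P = 0") (auto simp: power2_eq_square)
  show ?thesis
  proof (cases "?a = 0 \<or> ?b = 0")
    case True
    then have "?P \<le> 0"
    proof
      assume "?a = 0"
      then show ?thesis using q[of _ 1] by (intro nonpos[of _ "?b\<^sup>2"]) simp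
    next
      assume "?b = 0"
      then show ?thesis using q[of 1] by (intro nonpos[of _ "?a\<^sup>2"]) simp
    qed
    then show ?thesis using True by auto
  next
    case False
    then have "?a > 0" "?b > 0" by (simp_all add: less_le)
    \<comment> \<open>The choice \<open>s = ?b\<close>, \<open>t = ?a\<close> makes the two terms on
      the right of \<open>q\<close> equal.\<close>
    moreover have "2 * (?b * ?a) * ?P \<le> 2 * (?a * ?b) * (?a * ?b)"
      using q[of ?b ?a] by (simp add: power2_eq_square algebra_simps)
    ultimately show ?thesis by simp
  qed
qed

lemma l2_inner_norm_le:
  assumes "f \<in> L2_circle" "g \<in> L2_circle"
  shows "cmod (l2_inner f g) \<le> l2_norm f * l2_norm g"
proof -
  have "cmod (l2_inner f g) \<le> (\<integral>z. cmod (f z * cnj (g z)) \<partial>circle_measure)"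
    unfolding l2_inner_def by (rule integral_norm_bound)
  also have "\<dots> \<le> l2_norm f * l2_norm g"
    using l2_cauchy_schwarz[OF assms] by (simp add: norm_mult)
  finally show ?thesis .
qed

text \<open>Fatou's lemma for the squared moduli. It carries coefficient bounds from partial sums to
  dilates, and later from dilates to boundary functions.\<close>

lemma L2_circle_fatou:
  assumes [measurable]: "\<And>k. f k \<in> borel_measurable circle_measure" "u \<in> borel_measurable circle_measure"
    and lim: "AE z in circle_measure. (\<lambda>k. f k z) \<longlonglongrightarrow> u z"
    and int: "\<And>k. f k \<in> L2_circle"
    and le: "\<And>k. (\<integral>z. (cmod (f k z))\<^sup>2 \<partial>circle_measure) \<le> B"
  shows "u \<in> L2_circle" "(\<integral>z. (cmod (u z))\<^sup>2 \<partial>circle_measure) \<le> B"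
proof -
  have B: "0 \<le> B" using order_trans[OF _ le[of 0]] by simp
  have "(\<integral>\<^sup>+z. ennreal ((cmod (u z))\<^sup>2) \<partial>circle_measure) =
      (\<integral>\<^sup>+z. liminf (\<lambda>k. ennreal ((cmod (f k z))\<^sup>2)) \<partial>circle_measure)"
  proof (rule nn_integral_cong_AE, use lim in eventually_elim)
    fix z assume "(\<lambda>k. f k z) \<longlonglongrightarrow> u z"
    then have "(\<lambda>k. ennreal ((cmod (f k z))\<^sup>2)) \<longlonglongrightarrow> ennreal ((cmod (u z))\<^sup>2)"
      by (intro tendsto_ennrealI tendsto_intros)
    from lim_imp_Liminf[OF _ this] show "ennreal ((cmod (u z))\<^sup>2) = liminf (\<lambda>k. ennreal ((cmod (f k z))\<^sup>2))"
      by simp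
  qed
  also have "\<dots> \<le> liminf (\<lambda>k. \<integral>\<^sup>+z. ennreal ((cmod (f k z))\<^sup>2) \<partial>circle_measure)"
    by (rule nn_integral_liminf) measurable
  also have "\<dots> \<le> ennreal B"
    using le by (intro Liminf_le always_eventually allI)
      (auto simp: nn_integral_eq_integral[OF L2_circle_integrable_sq[OF int]] intro!: ennreal_leI)
  finally have *: "(\<integral>\<^sup>+z. ennreal ((cmod (u z))\<^sup>2) \<partial>circle_measure) \<le> ennreal B" .
  have "integrable circle_measure (\<lambda>z. (cmod (u z))\<^sup>2)"
    by (rule integrableI_bounded) (use * in \<open>auto intro: le_less_trans\<close>)
  then show "u \<in> L2_circle" by (simp add: L2_circle_def)
  show "(\<integral>z. (cmod (u z))\<^sup>2 \<partial>circle_measure) \<le> B"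
    by (rule integral_real_bounded[OF B *])
qed

section \<open>Poisson kernels\<close>

lemma circle_integrable_continuous:
  fixes f :: "complex \<Rightarrow> 'a :: {banach, second_countable_topology}"
  assumes "continuous_on (sphere 0 1) f"
  shows "integrable circle_measure f"
proof -
  have "compact (f ` sphere 0 1)" by (rule compact_continuous_image[OF assms]) simp
  then obtain B where "\<forall>x\<in>f ` sphere 0 1. norm x \<le> B"
    using compact_imp_bounded bounded_iff by blast
  then show ?thesis
    by (intro circle.integrable_const_bound[of _ B] borel_measurable_circleI assms AE_I2) auto
qed

lemma one_minus_mult_nonzero:
  assumes "cmod z < 1" "cmod w \<le> 1"
  shows "1 - z * w \<noteq> 0" "1 - w * z \<noteq> 0"
proof -
  have "cmod (z * w) < 1"
    using assms mult_left_le[of "cmod w" "cmod z"] by (simp add: norm_mult)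
  then show "1 - z * w \<noteq> 0" "1 - w * z \<noteq> 0" by (auto simp: mult.commute)
qed

text \<open>The Cauchy kernel is a geometric series in \<open>z * cnj t\<close>, dominated by the
  powers of \<open>cmod z\<close>, so it may be integrated term by term. Cauchy integrals are
  thereby read off from Fourier coefficients.\<close>

lemma circle_cauchy_sums:
  assumes "integrable circle_measure f" "cmod z < 1"
  shows "(\<lambda>n. z ^ n * (\<integral>t. f t * cnj t ^ n \<partial>circle_measure)) sums
    (\<integral>t. f t / (1 - z * cnj t) \<partial>circle_measure)"
proof -
  have [measurable]: "f \<in> borel_measurable circle_measure" using assms(1) by measurable
  have pm [measurable]: "(\<lambda>t. (z * cnj t) ^ n) \<in> borel_measurable circle_measure" for n
    by (intro borel_measurable_circleI continuous_intros)
  have i: "integrable circle_measure (\<lambda>t. f t * (z * cnj t) ^ n)" for n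
    using assms(1)
    by (rule Bochner_Integration.integrable_bound)
       (use assms(2) in \<open>auto intro!: AE_I2 mult_left_le power_le_one simp: norm_mult norm_power\<close>)
  have norm: "norm (f t * (z * cnj t) ^ n) = cmod (f t) * cmod z ^ n" if "cmod t = 1" for t n
    using that by (simp add: norm_mult norm_power)
  have "(\<lambda>n. \<integral>t. f t * (z * cnj t) ^ n \<partial>circle_measure) sums
      (\<integral>t. (\<Sum>n. f t * (z * cnj t) ^ n) \<partial>circle_measure)"
  proof (rule sums_integral[OF i])
    show "AE t in circle_measure. summable (\<lambda>n. norm (f t * (z * cnj t) ^ n))"
      using assms(2) by (intro AE_I2) (auto simp: norm intro!: summable_mult summable_geometric)
    have "(\<integral>t. norm (f t * (z * cnj t) ^ n) \<partial>circle_measure) =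
        (\<integral>t. cmod (f t) * cmod z ^ n \<partial>circle_measure)" for n
      by (rule Bochner_Integration.integral_cong) (auto simp: norm)
    then show "summable (\<lambda>n. \<integral>t. norm (f t * (z * cnj t) ^ n) \<partial>circle_measure)"
      using assms(2) by (auto intro!: summable_mult summable_geometric)
  qed
  moreover have "(\<integral>t. (\<Sum>n. f t * (z * cnj t) ^ n) \<partial>circle_measure) =
      (\<integral>t. f t / (1 - z * cnj t) \<partial>circle_measure)"
    using assms(2)
    by (intro Bochner_Integration.integral_cong)
       (auto simp: norm_mult suminf_mult suminf_geometric summable_geometric)
  moreover have "(\<integral>t. f t * (z * cnj t) ^ n \<partial>circle_measure) =
      z ^ n * (\<integral>t. f t * cnj t ^ n \<partial>circle_measure)" for n
    by (subst integral_mult_right_zero[symmetric])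
       (auto simp: power_mult_distrib mult_ac intro!: Bochner_Integration.integral_cong)
  ultimately show ?thesis by simp
qed

text \<open>For \<open>t\<close> on the circle the denominator equals the customary
  \<open>(cmod (t - z))^2\<close>. The form chosen here displays the Cauchy kernel
  \<open>1 / (1 - cnj z * t)\<close>.\<close>

definition poisson :: "complex \<Rightarrow> complex \<Rightarrow> real" where
  "poisson z t = (1 - (cmod z)\<^sup>2) / (cmod (1 - cnj z * t))\<^sup>2"

lemma poisson_nonneg: "cmod z < 1 \<Longrightarrow> 0 \<le> poisson z t"
  unfolding poisson_def by (intro divide_nonneg_nonneg) (auto simp: power_le_one)

text \<open>Serves twice: with \<open>v = cnj z * t\<close> it splits the Poisson kernel into Cauchy
  kernels, and with \<open>v = cnj z * w\<close> it evaluates the pairing of two Poisson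
  kernels.\<close>

lemma inverse_plus_cnj_inverse:
  assumes "v \<noteq> 1"
  shows "1 / (1 - v) + 1 / (1 - cnj v) - 1 = of_real ((1 - (cmod v)\<^sup>2) / (cmod (1 - v))\<^sup>2)"
proof -
  define a where "a = 1 - v"
  have a: "a \<noteq> 0" "cnj a \<noteq> 0" "v = 1 - a" using assms by (auto simp: a_def)
  have "1 / a + 1 / cnj a - 1 = (1 - (1 - a) * cnj (1 - a)) / (a * cnj a)"
    using a(1,2) by (simp add: field_simps)
  also have "\<dots> = of_real ((1 - (cmod (1 - a))\<^sup>2) / (cmod a)\<^sup>2)"
    by (simp only: of_real_divide of_real_diff complex_norm_square of_real_1)
  finally show ?thesis by (simp add: a(3))
qed

lemma poisson_eq:
  assumes "cmod z < 1" "cmod t = 1"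
  shows "of_real (poisson z t) = 1 / (1 - z * cnj t) + 1 / (1 - cnj z * t) - 1"
  using inverse_plus_cnj_inverse[of "cnj z * t"] one_minus_mult_nonzero[of "cnj z" t] assms
  by (simp add: poisson_def norm_mult add.commute)

lemma poisson_continuous: "cmod z < 1 \<Longrightarrow> continuous_on (sphere 0 1) (poisson z)"
  unfolding poisson_def using one_minus_mult_nonzero[of "cnj z"]
  by (intro continuous_intros) auto

lemma integral_mult_poisson:
  assumes "cmod z < 1" and c: "continuous_on (sphere 0 1) f"
  shows "(\<integral>t. f t * of_real (poisson z t) \<partial>circle_measure) =
    (\<integral>t. f t / (1 - z * cnj t) \<partial>circle_measure) + (\<integral>t. f t / (1 - cnj z * t) \<partial>circle_measure)
      - (\<integral>t. f t \<partial>circle_measure)"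
proof -
  have "(\<integral>t. f t * of_real (poisson z t) \<partial>circle_measure) =
      (\<integral>t. f t / (1 - z * cnj t) + f t / (1 - cnj z * t) - f t \<partial>circle_measure)"
    using assms by (intro Bochner_Integration.integral_cong) (auto simp: poisson_eq algebra_simps)
  also have "\<dots> = (\<integral>t. f t / (1 - z * cnj t) \<partial>circle_measure)
      + (\<integral>t. f t / (1 - cnj z * t) \<partial>circle_measure) - (\<integral>t. f t \<partial>circle_measure)"
  proof -
    have "integrable circle_measure (\<lambda>t. f t / (1 - z * cnj t))"
      using assms one_minus_mult_nonzero[of z]
      by (intro circle_integrable_continuous continuous_intros) auto
    moreover have "integrable circle_measure (\<lambda>t. f t / (1 - cnj z * t))"
      using assms one_minus_mult_nonzero[of "cnj z"]
      by (intro circle_integrable_continuous continuous_intros) auto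
    moreover have "integrable circle_measure f"
      by (rule circle_integrable_continuous[OF c])
    ultimately show ?thesis by simp
  qed
  finally show ?thesis .
qed

text \<open>One Cauchy kernel picks out the coefficient of \<open>t ^ m\<close>; the conjugate one
  sees only the constant term, which cancels against the subtracted mean.\<close>

lemma integral_power_poisson:
  assumes "cmod z < 1"
  shows "(\<integral>t. t ^ m * of_real (poisson z t) \<partial>circle_measure) = z ^ m"
proof -
  have "(\<lambda>n. z ^ n * (\<integral>t. t ^ m * cnj t ^ n \<partial>circle_measure)) sums
      (\<integral>t. t ^ m / (1 - z * cnj t) \<partial>circle_measure)"
    by (intro circle_cauchy_sums assms circle_integrable_continuous continuous_intros)
  then have "(\<lambda>n. if n = m then z ^ n else 0) sums (\<integral>t. t ^ m / (1 - z * cnj t) \<partial>circle_measure)"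
    by (rule back_subst[of "\<lambda>f. f sums _"]) (auto simp: circle_orthonormal)
  then have 1: "(\<integral>t. t ^ m / (1 - z * cnj t) \<partial>circle_measure) = z ^ m"
    by (rule sums_unique2) (rule sums_single)
  have c: "(\<integral>t. cnj t ^ m * cnj t ^ n \<partial>circle_measure) = (if n = 0 then (if m = 0 then 1 else 0) else 0)" for n
    using integral_circle_power[of "m + n"] integral_circle_cnj[of "\<lambda>t. t ^ (m + n)"]
    by (auto simp: power_add)
  have "(\<lambda>n. z ^ n * (\<integral>t. cnj t ^ m * cnj t ^ n \<partial>circle_measure)) sums
      (\<integral>t. cnj t ^ m / (1 - z * cnj t) \<partial>circle_measure)"
    by (intro circle_cauchy_sums assms circle_integrable_continuous continuous_intros)
  then have "(\<lambda>n. if n = 0 then (if m = 0 then 1 else 0) else 0) sums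
      (\<integral>t. cnj t ^ m / (1 - z * cnj t) \<partial>circle_measure)"
    unfolding c by (rule back_subst[of "\<lambda>f. f sums _"]) auto
  then have 2: "(\<integral>t. cnj t ^ m / (1 - z * cnj t) \<partial>circle_measure) = (if m = 0 then 1 else 0)"
    by (rule sums_unique2) (rule sums_single)
  have 3: "(\<integral>t. t ^ m / (1 - cnj z * t) \<partial>circle_measure) = (if m = 0 then 1 else 0)"
    using arg_cong[OF 2, of cnj] by (subst (asm) integral_circle_cnj[symmetric]) (simp split: if_splits)
  show ?thesis
    using assms by (subst integral_mult_poisson) (auto intro!: continuous_intros simp: 1 3 integral_circle_power)
qed

lemma integral_poisson: "cmod z < 1 \<Longrightarrow> (\<integral>t. poisson z t \<partial>circle_measure) = 1"
  using integral_power_poisson[of z 0] by (simp only: power_0 mult_1 integral_complex_of_real of_real_eq_1_iff)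

text \<open>Conjugating \<open>integral_power_poisson\<close> shows that the kernel at
  \<open>w\<close> has Fourier coefficients \<open>cnj w ^ n\<close>, so its Cauchy integral at
  \<open>z\<close> is a geometric series in \<open>z * cnj w\<close>.\<close>

lemma integral_poisson_poisson:
  assumes z: "cmod z < 1" and w: "cmod w < 1"
  shows "(\<integral>t. poisson w t * poisson z t \<partial>circle_measure) =
    (1 - (cmod z)\<^sup>2 * (cmod w)\<^sup>2) / (cmod (1 - cnj z * w))\<^sup>2"
proof -
  let ?P = "\<lambda>t. complex_of_real (poisson w t)"
  have cP: "continuous_on (sphere 0 1) ?P"
    by (intro continuous_intros poisson_continuous w)
  have c: "(\<integral>t. ?P t * cnj t ^ n \<partial>circle_measure) = cnj w ^ n" for n
    using arg_cong[OF integral_power_poisson[OF w, of n], of cnj]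
    by (subst (asm) integral_circle_cnj[symmetric]) (simp add: mult.commute)
  have "(\<lambda>n. z ^ n * cnj w ^ n) sums (\<integral>t. ?P t / (1 - z * cnj t) \<partial>circle_measure)"
    unfolding c[symmetric] by (intro circle_cauchy_sums z circle_integrable_continuous cP)
  moreover have "cmod (z * cnj w) < 1"
    using z w mult_strict_mono[of "cmod z" 1 "cmod w" 1] by (simp add: norm_mult)
  then have "(\<lambda>n. (z * cnj w) ^ n) sums (1 / (1 - z * cnj w))"
    by (rule geometric_sums)
  ultimately have 1: "(\<integral>t. ?P t / (1 - z * cnj t) \<partial>circle_measure) = 1 / (1 - z * cnj w)"
    by (simp add: power_mult_distrib sums_unique2)
  have 2: "(\<integral>t. ?P t / (1 - cnj z * t) \<partial>circle_measure) = 1 / (1 - cnj z * w)"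
    using arg_cong[OF 1, of cnj] by (subst (asm) integral_circle_cnj[symmetric]) simp
  have "(\<integral>t. ?P t * of_real (poisson z t) \<partial>circle_measure) =
      1 / (1 - cnj z * w) + 1 / (1 - cnj (cnj z * w)) - 1"
    by (subst integral_mult_poisson[OF z cP]) (simp add: 1 2 integral_poisson w)
  also have "\<dots> = of_real ((1 - (cmod (cnj z * w))\<^sup>2) / (cmod (1 - cnj z * w))\<^sup>2)"
    using one_minus_mult_nonzero[of "cnj z" w] z w by (intro inverse_plus_cnj_inverse) auto
  finally have "complex_of_real (\<integral>t. poisson w t * poisson z t \<partial>circle_measure) = \<dots>"
    by (simp flip: of_real_mult)
  then show ?thesis unfolding of_real_eq_iff by (simp add: norm_mult power_mult_distrib)
qed

text \<open>Since \<open>1 - cmod w\<close> is at most \<open>cmod (1 - cnj z * w)\<close>, moving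
  from \<open>w\<close> to \<open>t\<close> enlarges the denominator by a factor of at most
  \<open>1 + \<alpha>\<close> before squaring. The kernel at the interior point \<open>w\<close> is
  thus controlled at every \<open>t\<close> in the shadow of \<open>w\<close>.\<close>

lemma stolz_region_poisson_bound:
  assumes z: "cmod z < 1" and t: "cmod t = 1" and w: "w \<in> stolz_region \<alpha> t"
  shows "(1 - (cmod z)\<^sup>2) / (cmod (1 - cnj z * w))\<^sup>2 \<le> (1 + \<alpha>)\<^sup>2 * poisson z t"
proof -
  have w1: "cmod w < 1" and wt: "cmod (w - t) < \<alpha> * (1 - cmod w)"
    using w by (auto simp: stolz_region_def)
  have a: "0 \<le> \<alpha>" using wt w1 by (smt (verit) norm_ge_zero mult_nonpos_nonneg)
  have "1 - cmod w \<le> 1 - cmod z * cmod w"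
    using z w1 mult_right_mono[of "cmod z" 1 "cmod w"] by simp
  also have "\<dots> \<le> cmod (1 - cnj z * w)"
    using norm_triangle_ineq2[of 1 "cnj z * w"] by (simp add: norm_mult)
  finally have le: "1 - cmod w \<le> cmod (1 - cnj z * w)" .
  have "cmod (1 - cnj z * t) \<le> cmod (1 - cnj z * w) + cmod (cnj z * (w - t))"
    using norm_triangle_ineq[of "1 - cnj z * w" "cnj z * (w - t)"] by (simp add: algebra_simps)
  also have "cmod (cnj z * (w - t)) \<le> \<alpha> * (1 - cmod w)"
    using mult_mono[of "cmod z" 1 "cmod (w - t)" "\<alpha> * (1 - cmod w)"] z wt by (simp add: norm_mult)
  also have "\<dots> \<le> \<alpha> * cmod (1 - cnj z * w)" using le a by (rule mult_left_mono)
  finally have "(cmod (1 - cnj z * t))\<^sup>2 \<le> ((1 + \<alpha>) * cmod (1 - cnj z * w))\<^sup>2"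
    by (intro power_mono) (auto simp: algebra_simps)
  moreover have "cmod (1 - cnj z * t) > 0" "cmod (1 - cnj z * w) > 0"
    using one_minus_mult_nonzero[of "cnj z"] z t w1 by auto
  moreover have "0 \<le> 1 - (cmod z)\<^sup>2" using z by (simp add: power_le_one)
  ultimately have "(1 - (cmod z)\<^sup>2) * (cmod (1 - cnj z * t))\<^sup>2 \<le>
      (1 - (cmod z)\<^sup>2) * ((1 + \<alpha>) * cmod (1 - cnj z * w))\<^sup>2"
    by (intro mult_left_mono)
  moreover have "x / b \<le> (1 + \<alpha>)\<^sup>2 * (x / a)" if "x * a \<le> x * ((1 + \<alpha>)\<^sup>2 * b)" "a > 0" "b > 0" for x a b
    using that by (simp add: field_simps)
  ultimately show ?thesis
    using \<open>cmod (1 - cnj z * t) > 0\<close> \<open>cmod (1 - cnj z * w) > 0\<close>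
    by (simp add: poisson_def power_mult_distrib)
qed

text \<open>A Schur-type argument: after the square is expanded, every row sum of the matrix
  \<open>m j * b i j\<close> is at most \<open>(1 + \<alpha>)^2\<close>, so the double sum stays
  linear in the total measure.\<close>

lemma integral_sum_poisson_squared:
  assumes I: "finite I" and z: "\<And>i. i \<in> I \<Longrightarrow> cmod (z i) < 1"
    and A: "\<And>i. i \<in> I \<Longrightarrow> A i \<in> sets circle_measure" and disj: "disjoint_family_on A I"
    and st: "\<And>i t. i \<in> I \<Longrightarrow> t \<in> A i \<Longrightarrow> z i \<in> stolz_region \<alpha> t"
  defines "m \<equiv> \<lambda>i. measure circle_measure (A i)"
  shows "(\<integral>t. (\<Sum>i\<in>I. m i * poisson (z i) t)\<^sup>2 \<partial>circle_measure) \<le> 2 * (1 + \<alpha>)\<^sup>2 * (\<Sum>i\<in>I. m i)"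
proof -
  define b where "b i j = (1 - (cmod (z i))\<^sup>2) / (cmod (1 - cnj (z i) * z j))\<^sup>2" for i j
  have m0: "0 \<le> m i" for i by (simp add: m_def)
  have Pi: "integrable circle_measure (\<lambda>t. poisson (z i) t)" if "i \<in> I" for i
    by (intro circle_integrable_continuous poisson_continuous z that)
  have PPi: "integrable circle_measure (\<lambda>t. poisson (z i) t * poisson (z j) t)" if "i \<in> I" "j \<in> I" for i j
    by (intro circle_integrable_continuous continuous_on_mult poisson_continuous z that)
  \<comment> \<open>The inequality \<open>1 - x * y \<le> (1 - x) + (1 - y)\<close> splits the
    numerator of the symmetric closed form into one term for each of the two points.\<close>
  have K: "(\<integral>t. poisson (z i) t * poisson (z j) t \<partial>circle_measure) \<le> b i j + b j i"
    if "i \<in> I" "j \<in> I" for i j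
  proof -
    have x: "(cmod (z i))\<^sup>2 \<le> 1" "(cmod (z j))\<^sup>2 \<le> 1" using that z by (auto simp: power_le_one less_imp_le)
    have "1 - x * y \<le> (1 - x) + (1 - y)" if "x \<le> 1" "y \<le> 1" for x y :: real
      using mult_nonneg_nonneg[of "1 - x" "1 - y"] that by (simp add: algebra_simps)
    from this[OF x] have *: "1 - (cmod (z j))\<^sup>2 * (cmod (z i))\<^sup>2 \<le> (1 - (cmod (z i))\<^sup>2) + (1 - (cmod (z j))\<^sup>2)"
      by (simp add: mult.commute)
    have "cmod (1 - cnj (z i) * z j) = cmod (cnj (1 - cnj (z i) * z j))" by (rule complex_mod_cnj[symmetric])
    also have "\<dots> = cmod (1 - cnj (z j) * z i)" by (simp add: mult.commute)
    finally show ?thesis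
      using divide_right_mono[OF *, of "(cmod (1 - cnj (z j) * z i))\<^sup>2"]
      by (simp add: integral_poisson_poisson z that b_def add_divide_distrib[symmetric])
  qed
  \<comment> \<open>As \<open>b i j\<close> does not depend on \<open>t\<close>, the pointwise
    comparison of kernels can be integrated over \<open>A j\<close>.\<close>
  have B: "m j * b i j \<le> (1 + \<alpha>)\<^sup>2 * (\<integral>t. indicator (A j) t * poisson (z i) t \<partial>circle_measure)"
    if "i \<in> I" "j \<in> I" for i j
  proof -
    note [measurable] = A[OF that(2)]
    have "m j * b i j = (\<integral>t. indicator (A j) t * b i j \<partial>circle_measure)"
      using A[OF that(2)] by (simp add: m_def Int_absorb2 sets.sets_into_space[OF A[OF that(2)], simplified])
    also have "\<dots> \<le> (\<integral>t. (1 + \<alpha>)\<^sup>2 * (indicator (A j) t * poisson (z i) t) \<partial>circle_measure)"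
    proof (rule integral_mono)
      show "integrable circle_measure (\<lambda>t. (1 + \<alpha>)\<^sup>2 * (indicator (A j) t * poisson (z i) t))"
        using integrable_real_mult_indicator[OF A[OF that(2)] Pi[OF that(1)]] by (simp add: mult.commute)
      show "integrable circle_measure (\<lambda>t. indicator (A j) t * b i j)"
        by (intro integrable_mult_left integrable_real_indicator) (auto simp: circle.emeasure_finite less_top[symmetric])
      fix t assume "t \<in> space circle_measure"
      then show "indicator (A j) t * b i j \<le> (1 + \<alpha>)\<^sup>2 * (indicator (A j) t * poisson (z i) t)"
        using stolz_region_poisson_bound[OF z[OF that(1)] _ st[OF that(2)], of t]
        by (auto simp: b_def indicator_def)
    qed
    finally show ?thesis by simp
  qed
  \<comment> \<open>By disjointness the integrals over the sets \<open>A j\<close> add up to at most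
    the total mass 1 of the kernel at \<open>z i\<close>.\<close>
  have S: "(\<Sum>j\<in>I. m j * b i j) \<le> (1 + \<alpha>)\<^sup>2" if i: "i \<in> I" for i
  proof -
    have "(\<Sum>j\<in>I. m j * b i j) \<le> (1 + \<alpha>)\<^sup>2 * (\<Sum>j\<in>I. \<integral>t. indicator (A j) t * poisson (z i) t \<partial>circle_measure)"
      unfolding sum_distrib_left by (intro sum_mono B i)
    also have "(\<Sum>j\<in>I. \<integral>t. indicator (A j) t * poisson (z i) t \<partial>circle_measure) =
        (\<integral>t. (\<Sum>j\<in>I. indicator (A j) t * poisson (z i) t) \<partial>circle_measure)"
      using integrable_real_mult_indicator[OF A Pi[OF i]]
      by (intro Bochner_Integration.integral_sum[symmetric]) (simp add: mult.commute)
    also have "\<dots> = (\<integral>t. poisson (z i) t * indicator (\<Union>j\<in>I. A j) t \<partial>circle_measure)"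
      by (simp add: indicator_UN_disjoint[OF I disj] sum_distrib_left mult.commute)
    also have "\<dots> \<le> (\<integral>t. poisson (z i) t \<partial>circle_measure)"
      using I A by (intro integral_mono integrable_real_mult_indicator Pi i)
        (auto simp: indicator_def poisson_nonneg z i)
    also have "\<dots> = 1" by (rule integral_poisson[OF z[OF i]])
    finally show ?thesis by (simp add: mult_left_mono)
  qed
  have "(\<integral>t. (\<Sum>i\<in>I. m i * poisson (z i) t)\<^sup>2 \<partial>circle_measure) =
      (\<integral>t. (\<Sum>i\<in>I. \<Sum>j\<in>I. m i * m j * (poisson (z i) t * poisson (z j) t)) \<partial>circle_measure)"
    by (simp add: power2_eq_square sum_product mult_ac)
  also have "\<dots> = (\<Sum>i\<in>I. \<Sum>j\<in>I. m i * m j * (\<integral>t. poisson (z i) t * poisson (z j) t \<partial>circle_measure))"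
    using PPi by (simp add: Bochner_Integration.integral_sum)
  also have "\<dots> \<le> (\<Sum>i\<in>I. \<Sum>j\<in>I. m i * m j * (b i j + b j i))"
    using m0 K by (intro sum_mono mult_left_mono) auto
  also have "\<dots> = 2 * (\<Sum>i\<in>I. m i * (\<Sum>j\<in>I. m j * b i j))"
  proof -
    have "(\<Sum>i\<in>I. \<Sum>j\<in>I. m i * m j * b j i) = (\<Sum>i\<in>I. \<Sum>j\<in>I. m i * m j * b i j)"
      by (subst sum.swap) (simp add: mult_ac)
    then show ?thesis by (simp add: distrib_left sum.distrib sum_distrib_left mult_ac)
  qed
  also have "\<dots> \<le> 2 * (\<Sum>i\<in>I. m i * (1 + \<alpha>)\<^sup>2)"
    using m0 S by (intro mult_left_mono sum_mono) auto
  also have "\<dots> = 2 * (1 + \<alpha>)\<^sup>2 * (\<Sum>i\<in>I. m i)"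
    by (simp only: sum_distrib_right[symmetric] mult_ac)
  finally show ?thesis .
qed

section \<open>Square-summable power series\<close>

lemma L2_circle_power: "(\<lambda>t. t ^ n) \<in> L2_circle"
  by (intro L2_circle_continuous continuous_intros)

lemma L2_circle_sum: "(\<And>i. i \<in> I \<Longrightarrow> f i \<in> L2_circle) \<Longrightarrow> (\<lambda>t. \<Sum>i\<in>I. f i t) \<in> L2_circle"
  by (induction I rule: infinite_finite_induct) (auto intro: L2_circle_add L2_circle_const)

lemma l2_inner_sum_left:
  "g \<in> L2_circle \<Longrightarrow> (\<And>i. i \<in> I \<Longrightarrow> f i \<in> L2_circle) \<Longrightarrow>
    l2_inner (\<lambda>t. \<Sum>i\<in>I. f i t) g = (\<Sum>i\<in>I. l2_inner (f i) g)"
  unfolding l2_inner_def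
  by (simp add: sum_distrib_right Bochner_Integration.integral_sum l2_inner_integrable)

lemma l2_inner_sum_right:
  "g \<in> L2_circle \<Longrightarrow> (\<And>i. i \<in> I \<Longrightarrow> f i \<in> L2_circle) \<Longrightarrow>
    l2_inner g (\<lambda>t. \<Sum>i\<in>I. f i t) = (\<Sum>i\<in>I. l2_inner g (f i))"
  unfolding l2_inner_def
  by (simp add: cnj_sum sum_distrib_left Bochner_Integration.integral_sum l2_inner_integrable)

lemma l2_inner_power_power: "l2_inner (\<lambda>t. t ^ m) (\<lambda>t. t ^ n) = (if m = n then 1 else 0)"
  by (simp add: l2_inner_def circle_orthonormal)

definition circle_poly :: "(nat \<Rightarrow> complex) \<Rightarrow> nat \<Rightarrow> complex \<Rightarrow> complex" where
  "circle_poly a N t = (\<Sum>n<N. a n * t ^ n)"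

lemma L2_circle_poly: "circle_poly a N \<in> L2_circle"
  unfolding circle_poly_def[abs_def] by (intro L2_circle_sum L2_circle_mult L2_circle_power)

lemma continuous_on_circle_poly [continuous_intros]: "continuous_on S (circle_poly a N)"
  unfolding circle_poly_def[abs_def] by (intro continuous_intros)

lemma l2_inner_circle_poly_right:
  "h \<in> L2_circle \<Longrightarrow> l2_inner h (circle_poly a N) = (\<Sum>n<N. cnj (a n) * l2_inner h (\<lambda>t. t ^ n))"
  unfolding circle_poly_def[abs_def]
  by (subst l2_inner_sum_right) (auto intro: L2_circle_mult L2_circle_power simp: l2_inner_mult_right)

lemma l2_inner_circle_poly_left:
  "l2_inner (circle_poly a N) (\<lambda>t. t ^ m) = (if m < N then a m else 0)"
  unfolding circle_poly_def[abs_def]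
  by (subst l2_inner_sum_left)
     (auto intro: L2_circle_mult L2_circle_power simp: l2_inner_mult_left l2_inner_power_power if_distrib
       cong: if_cong)

lemma l2_norm_circle_poly: "(l2_norm (circle_poly a N))\<^sup>2 = (\<Sum>n<N. (cmod (a n))\<^sup>2)"
proof -
  have "complex_of_real ((l2_norm (circle_poly a N))\<^sup>2) = (\<Sum>n<N. cnj (a n) * a n)"
    unfolding l2_inner_self[symmetric] l2_inner_circle_poly_right[OF L2_circle_poly]
    by (simp add: l2_inner_circle_poly_left)
  also have "\<dots> = of_real (\<Sum>n<N. (cmod (a n))\<^sup>2)"
    by (simp add: complex_norm_square mult.commute del: of_real_power)
  finally show ?thesis by (simp only: of_real_eq_iff)
qed

text \<open>Pairing \<open>h\<close> with its own Fourier polynomial gives the squared norm of that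
  polynomial; Cauchy-Schwarz then allows one factor to be cancelled.\<close>

lemma l2_bessel:
  assumes h: "h \<in> L2_circle"
  shows "(\<Sum>n<N. (cmod (l2_inner h (\<lambda>t. t ^ n)))\<^sup>2) \<le> (l2_norm h)\<^sup>2"
proof -
  let ?a = "\<lambda>n. l2_inner h (\<lambda>t. t ^ n)"
  let ?S = "\<Sum>n<N. (cmod (?a n))\<^sup>2" and ?p = "circle_poly ?a N"
  have "l2_inner h ?p = of_real ?S"
    by (simp add: l2_inner_circle_poly_right[OF h] complex_norm_square mult.commute del: of_real_power)
  then have "cmod (l2_inner h ?p) = ?S"
    by (simp only: norm_of_real) (simp add: sum_nonneg)
  then have "(l2_norm ?p)\<^sup>2 \<le> l2_norm h * l2_norm ?p"
    using l2_inner_norm_le[OF h L2_circle_poly, of ?a N] by (simp add: l2_norm_circle_poly)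
  then have "l2_norm ?p \<le> l2_norm h"
    by (cases "l2_norm ?p = 0") (auto simp: power2_eq_square less_le)
  then show ?thesis
    unfolding l2_norm_circle_poly[symmetric] by (intro power_mono) auto
qed

text \<open>The coefficient description of the Hardy space; \<open>h2_series_in_H2\<close> and
  \<open>H2_disc_series\<close> connect it with the definition by integral means.\<close>

definition h2_series :: "(nat \<Rightarrow> complex) \<Rightarrow> (complex \<Rightarrow> complex) \<Rightarrow> bool" where
  "h2_series a F \<longleftrightarrow> summable (\<lambda>n. (cmod (a n))\<^sup>2) \<and> (\<forall>z\<in>ball 0 1. (\<lambda>n. a n * z ^ n) sums F z)"

lemma h2_series_holomorphic: "h2_series a F \<Longrightarrow> F holomorphic_on ball 0 1"
  by (rule power_series_holomorphic[of 0 1 a]) (auto simp: h2_series_def)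

lemma h2_series_poly_tendsto:
  "h2_series a F \<Longrightarrow> cmod z < 1 \<Longrightarrow> (\<lambda>N. circle_poly a N z) \<longlonglongrightarrow> F z"
  by (simp add: h2_series_def sums_def circle_poly_def)

lemma h2_series_sum_le: "h2_series a F \<Longrightarrow> (\<Sum>n<N. (cmod (a n))\<^sup>2) \<le> (\<Sum>n. (cmod (a n))\<^sup>2)"
  by (intro sum_le_suminf) (auto simp: h2_series_def)

text \<open>Zeroing the first coefficients without shifting the index keeps the remainder an
  \<open>h2_series\<close>, so every bound proved for such series applies to it.\<close>

lemma h2_series_tail:
  assumes "h2_series a F"
  shows "h2_series (\<lambda>n. if n < N then 0 else a n) (\<lambda>z. F z - circle_poly a N z)"
proof -
  have "(\<lambda>n. (if n < N then 0 else a n) * z ^ n) sums (F z - circle_poly a N z)" if "cmod z < 1" for z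
  proof -
    have "(\<lambda>n. a n * z ^ n - (if n < N then a n * z ^ n else 0)) sums (F z - (\<Sum>n<N. a n * z ^ n))"
      using assms that sums_If_finite_set[of "{..<N}" "\<lambda>n. a n * z ^ n"]
      by (intro sums_diff) (auto simp: h2_series_def)
    then show ?thesis
      unfolding circle_poly_def by (rule back_subst[of "\<lambda>f. f sums _"]) auto
  qed
  moreover have "summable (\<lambda>n. (cmod (if n < N then 0 else a n))\<^sup>2)"
    using assms by (intro summable_comparison_test[OF _ conjunct1[OF assms[unfolded h2_series_def]]]) auto
  ultimately show ?thesis by (simp add: h2_series_def)
qed

lemma h2_series_tail_tendsto_0:
  assumes "h2_series a F"
  shows "(\<lambda>N. \<Sum>n. (cmod (if n < N then 0 else a n))\<^sup>2) \<longlonglongrightarrow> 0"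
proof -
  have s: "summable (\<lambda>n. (cmod (a n))\<^sup>2)" using assms by (simp add: h2_series_def)
  have "(\<Sum>n. (cmod (if n < N then 0 else a n))\<^sup>2) = (\<Sum>n. (cmod (a (n + N)))\<^sup>2)" for N
  proof -
    have "summable (\<lambda>n. (cmod (if n < N then 0 else a n))\<^sup>2)"
      using h2_series_tail[OF assms, of N] by (simp add: h2_series_def)
    from suminf_split_initial_segment[OF this, of N] show ?thesis by simp
  qed
  then show ?thesis using suminf_exist_split2[OF s] by simp
qed

text \<open>The dilate has coefficients \<open>a n * r ^ n\<close>, no larger in modulus than
  \<open>a n\<close>, and is the pointwise limit of its partial sums on the circle; Parseval for
  polynomials and Fatou's lemma give both claims.\<close>

lemma h2_series_dilate:
  assumes F: "h2_series a F" and r: "0 \<le> r" "r < 1"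
  shows "(\<lambda>t. F (of_real r * t)) \<in> L2_circle"
    and "(\<integral>t. (cmod (F (of_real r * t)))\<^sup>2 \<partial>circle_measure) \<le> (\<Sum>n. (cmod (a n))\<^sup>2)"
proof -
  let ?b = "\<lambda>n. a n * of_real r ^ n"
  have m: "(\<lambda>t. F (of_real r * t)) \<in> borel_measurable circle_measure"
    using r by (intro borel_measurable_circleI
      continuous_on_compose2[OF holomorphic_on_imp_continuous_on[OF h2_series_holomorphic[OF F]]] continuous_intros)
      (auto simp: norm_mult)
  have lim: "AE t in circle_measure. (\<lambda>N. circle_poly ?b N t) \<longlonglongrightarrow> F (of_real r * t)"
  proof (rule AE_I2)
    fix t assume "t \<in> space circle_measure"
    then have "(\<lambda>N. circle_poly a N (of_real r * t)) \<longlonglongrightarrow> F (of_real r * t)"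
      using r by (intro h2_series_poly_tendsto[OF F]) (auto simp: norm_mult)
    then show "(\<lambda>N. circle_poly ?b N t) \<longlonglongrightarrow> F (of_real r * t)"
      by (simp add: circle_poly_def power_mult_distrib mult.assoc)
  qed
  have le: "(\<integral>t. (cmod (circle_poly ?b N t))\<^sup>2 \<partial>circle_measure) \<le> (\<Sum>n. (cmod (a n))\<^sup>2)" for N
  proof -
    have "(\<Sum>n<N. (cmod (?b n))\<^sup>2) \<le> (\<Sum>n<N. (cmod (a n))\<^sup>2)"
      using r by (intro sum_mono power_mono)
        (auto simp: norm_mult norm_power power_le_one intro!: mult_left_le)
    also have "\<dots> \<le> (\<Sum>n. (cmod (a n))\<^sup>2)" by (rule h2_series_sum_le[OF F])
    finally show ?thesis by (simp add: l2_norm_sq[symmetric] l2_norm_circle_poly)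
  qed
  note * = L2_circle_fatou[OF L2_circleD[OF L2_circle_poly] m lim L2_circle_poly le]
  show "(\<lambda>t. F (of_real r * t)) \<in> L2_circle" by (rule *)
  show "(\<integral>t. (cmod (F (of_real r * t)))\<^sup>2 \<partial>circle_measure) \<le> (\<Sum>n. (cmod (a n))\<^sup>2)" by (rule *)
qed

lemma h2_series_in_H2: "h2_series a F \<Longrightarrow> F \<in> H2_disc"
  unfolding H2_disc_def using h2_series_dilate(2) h2_series_holomorphic
  by (auto intro!: bdd_aboveI2)

text \<open>Bessel's inequality for the dilate of radius \<open>r\<close> bounds finitely many terms
  \<open>(cmod (a n) * r ^ n)^2\<close> by the common bound of the integral means; then
  \<open>r\<close> tends to 1.\<close>

lemma H2_disc_series:
  assumes "F \<in> H2_disc"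
  obtains a where "h2_series a F"
proof -
  define a where "a = (\<lambda>n. (deriv ^^ n) F 0 / fact n)"
  have hol: "F holomorphic_on ball 0 1" using assms by (simp add: H2_disc_def)
  have sums: "(\<lambda>n. a n * z ^ n) sums F z" if "cmod z < 1" for z
    using holomorphic_power_series[OF hol, of z] that by (simp add: a_def)
  obtain B where "\<forall>r\<in>{0..<1}. (\<integral>t. (cmod (F (of_real r * t)))\<^sup>2 \<partial>circle_measure) \<le> B"
    using assms by (auto simp: H2_disc_def bdd_above_def)
  then have B: "(\<integral>t. (cmod (F (of_real r * t)))\<^sup>2 \<partial>circle_measure) \<le> B" if "0 \<le> r" "r < 1" for r
    using that by auto
  have le: "(\<Sum>n<N. (cmod (a n) * r ^ n)\<^sup>2) \<le> B" if r: "0 \<le> r" "r < 1" for N r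
  proof -
    let ?F = "\<lambda>t. F (of_real r * t)"
    have F: "?F \<in> L2_circle"
      using r by (intro L2_circle_continuous
        continuous_on_compose2[OF holomorphic_on_imp_continuous_on[OF hol]] continuous_intros)
        (auto simp: norm_mult)
    \<comment> \<open>The Taylor series converges absolutely on the circle of radius
      \<open>r\<close>, so the Fourier coefficients of the dilate come from termwise
      integration.\<close>
    have c: "l2_inner ?F (\<lambda>t. t ^ n) = a n * of_real r ^ n" for n
    proof -
      have s: "summable (\<lambda>k. cmod (a k) * r ^ k)"
      proof -
        have "summable (\<lambda>n. norm (a n * of_real r ^ n))"
        proof (rule powser_insidea)
          \<comment> \<open>Convergence at a radius strictly between \<open>r\<close> and 1 yields
            absolute convergence at \<open>r\<close>.\<close>
          show "summable (\<lambda>n. a n * of_real ((1 + r) / 2) ^ n)"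
            using r by (intro sums_summable[OF sums]) (simp only: norm_of_real, auto)
        qed (use r in \<open>simp only: norm_of_real, auto\<close>)
        then show ?thesis using r by (simp add: norm_mult norm_power)
      qed
      let ?g = "\<lambda>k t. a k * of_real r ^ k * t ^ k * cnj t ^ n"
      have n: "norm (?g k t) = cmod (a k) * r ^ k" if "cmod t = 1" for k t
        using that r by (simp add: norm_mult norm_power)
      have "(\<lambda>k. \<integral>t. ?g k t \<partial>circle_measure) sums (\<integral>t. (\<Sum>k. ?g k t) \<partial>circle_measure)"
      proof (rule sums_integral)
        show "integrable circle_measure (?g k)" for k
          by (intro circle_integrable_continuous continuous_intros)
        show "AE t in circle_measure. summable (\<lambda>k. norm (?g k t))"
          using s by (intro AE_I2) (simp add: n)
        have "(\<integral>t. norm (?g k t) \<partial>circle_measure) = (\<integral>t. cmod (a k) * r ^ k \<partial>circle_measure)" for k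
          by (rule Bochner_Integration.integral_cong) (auto simp: n)
        then show "summable (\<lambda>k. \<integral>t. norm (?g k t) \<partial>circle_measure)" using s by simp
      qed
      moreover have "(\<integral>t. ?g k t \<partial>circle_measure) = (if k = n then a k * of_real r ^ k else 0)" for k
        using circle_orthonormal[of k n] by (simp add: mult.assoc)
      moreover have "(\<integral>t. (\<Sum>k. ?g k t) \<partial>circle_measure) = l2_inner ?F (\<lambda>t. t ^ n)"
        unfolding l2_inner_def
      proof (rule Bochner_Integration.integral_cong)
        fix t assume "t \<in> space circle_measure"
        then have "(\<lambda>k. a k * (of_real r * t) ^ k * cnj t ^ n) sums (?F t * cnj t ^ n)"
          using r by (intro sums_mult2 sums) (simp add: norm_mult)
        then show "(\<Sum>k. ?g k t) = ?F t * cnj (t ^ n)"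
          by (simp add: sums_iff power_mult_distrib mult.assoc)
      qed simp
      ultimately have "(\<lambda>k. if k = n then a k * of_real r ^ k else 0) sums l2_inner ?F (\<lambda>t. t ^ n)" by simp
      then show ?thesis by (rule sums_unique2) (rule sums_single)
    qed
    have "(\<Sum>n<N. (cmod (a n) * r ^ n)\<^sup>2) \<le> (l2_norm ?F)\<^sup>2"
      using l2_bessel[OF F, of N] r by (simp add: c norm_mult norm_power)
    also have "\<dots> \<le> B" unfolding l2_norm_sq using r by (rule B)
    finally show ?thesis .
  qed
  have "(\<Sum>n<N. (cmod (a n))\<^sup>2) \<le> B" for N
  proof (rule tendsto_upperbound)
    have "((\<lambda>r. \<Sum>n<N. (cmod (a n) * r ^ n)\<^sup>2) \<longlongrightarrow> (\<Sum>n<N. (cmod (a n) * 1 ^ n)\<^sup>2)) (at_left (1::real))"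
      by (intro tendsto_intros)
    then show "((\<lambda>r. \<Sum>n<N. (cmod (a n) * r ^ n)\<^sup>2) \<longlongrightarrow> (\<Sum>n<N. (cmod (a n))\<^sup>2)) (at_left (1::real))"
      by simp
    have "eventually (\<lambda>r. r \<in> {0<..<1}) (at_left (1::real))" by (rule eventually_at_left_real) simp
    then show "eventually (\<lambda>r. (\<Sum>n<N. (cmod (a n) * r ^ n)\<^sup>2) \<le> B) (at_left (1::real))"
      by eventually_elim (auto intro!: le)
  qed simp
  then have "summable (\<lambda>n. (cmod (a n))\<^sup>2)"
    by (intro summableI_nonneg_bounded[where x = B]) auto
  then have "h2_series a F" using sums by (simp add: h2_series_def)
  then show ?thesis by (rule that)
qed

section \<open>The non-tangential maximal inequality\<close>

lemma circle_poly_poisson: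
  assumes "cmod z < 1"
  shows "(\<integral>t. circle_poly a N t * of_real (poisson z t) \<partial>circle_measure) = circle_poly a N z"
proof -
  have "integrable circle_measure (\<lambda>t. a n * (t ^ n * of_real (poisson z t)))" for n
    by (intro circle_integrable_continuous continuous_intros poisson_continuous assms)
  then show ?thesis
    unfolding circle_poly_def sum_distrib_right mult.assoc
    by (subst Bochner_Integration.integral_sum) (auto simp: integral_power_poisson[OF assms])
qed

text \<open>Duality: the values at the points \<open>z i\<close> are tested against the combination of Poisson kernels
  whose norm is controlled by \<open>integral_sum_poisson_squared\<close>.\<close>

lemma h2_series_weighted_sum:
  assumes F: "h2_series a F" and I: "finite I" and z: "\<And>i. i \<in> I \<Longrightarrow> cmod (z i) < 1"
    and A: "\<And>i. i \<in> I \<Longrightarrow> A i \<in> sets circle_measure" and disj: "disjoint_family_on A I"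
    and st: "\<And>i t. i \<in> I \<Longrightarrow> t \<in> A i \<Longrightarrow> z i \<in> stolz_region \<alpha> t"
  defines "m \<equiv> \<lambda>i. measure circle_measure (A i)"
  shows "(\<Sum>i\<in>I. m i * cmod (F (z i)))\<^sup>2 \<le> (\<Sum>n. (cmod (a n))\<^sup>2) * (2 * (1 + \<alpha>)\<^sup>2 * (\<Sum>i\<in>I. m i))"
proof -
  let ?P = "\<lambda>t. \<Sum>i\<in>I. m i * poisson (z i) t"
  have m0: "0 \<le> m i" for i by (simp add: m_def)
  have cP: "continuous_on (sphere 0 1) ?P"
    by (intro continuous_intros poisson_continuous z)
  have cP': "continuous_on (sphere 0 1) (\<lambda>t. complex_of_real (?P t))"
    using cP by (rule continuous_on_of_real)
  have P0: "0 \<le> ?P t" for t by (intro sum_nonneg mult_nonneg_nonneg m0 poisson_nonneg z)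
  \<comment> \<open>Partial sums come first: they are continuous on the closed disc and have a
    Poisson representation, whereas boundary values of \<open>F\<close> are not yet available. The
    bound is uniform in \<open>N\<close>, so the limit can be taken at the finitely many
    points.\<close>
  have le: "(\<Sum>i\<in>I. m i * cmod (circle_poly a N (z i)))\<^sup>2 \<le>
      (\<Sum>n. (cmod (a n))\<^sup>2) * (2 * (1 + \<alpha>)\<^sup>2 * (\<Sum>i\<in>I. m i))" for N
  proof -
    let ?Q = "circle_poly a N"
    have int: "integrable circle_measure (\<lambda>t. m i * (cmod (?Q t) * poisson (z i) t))" if "i \<in> I" for i
      using that by (intro circle_integrable_continuous continuous_intros poisson_continuous z)
    have "(\<Sum>i\<in>I. m i * cmod (?Q (z i))) \<le>
        (\<Sum>i\<in>I. m i * (\<integral>t. cmod (?Q t) * poisson (z i) t \<partial>circle_measure))"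
    proof (intro sum_mono mult_left_mono m0)
      fix i assume i: "i \<in> I"
      have "cmod (?Q (z i)) \<le> (\<integral>t. norm (?Q t * of_real (poisson (z i) t)) \<partial>circle_measure)"
        unfolding circle_poly_poisson[OF z[OF i], symmetric] by (rule integral_norm_bound)
      then show "cmod (?Q (z i)) \<le> (\<integral>t. cmod (?Q t) * poisson (z i) t \<partial>circle_measure)"
        by (simp add: norm_mult poisson_nonneg z i)
    qed
    also have "\<dots> = (\<integral>t. cmod (?Q t) * cmod (of_real (?P t)) \<partial>circle_measure)"
      using int P0
      by (simp add: sum_distrib_left mult_ac Bochner_Integration.integral_sum[symmetric] del: of_real_sum)
    also have "\<dots> \<le> l2_norm ?Q * l2_norm (\<lambda>t. of_real (?P t))"
      by (intro l2_cauchy_schwarz L2_circle_poly L2_circle_continuous cP')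
    finally have "(\<Sum>i\<in>I. m i * cmod (?Q (z i)))\<^sup>2 \<le> (l2_norm ?Q * l2_norm (\<lambda>t. of_real (?P t)))\<^sup>2"
      by (intro power_mono sum_nonneg mult_nonneg_nonneg m0) auto
    also have "\<dots> = (\<Sum>n<N. (cmod (a n))\<^sup>2) * (\<integral>t. (?P t)\<^sup>2 \<partial>circle_measure)"
      unfolding power_mult_distrib l2_norm_circle_poly by (simp add: l2_norm_sq del: of_real_sum)
    also have "\<dots> \<le> (\<Sum>n. (cmod (a n))\<^sup>2) * (2 * (1 + \<alpha>)\<^sup>2 * (\<Sum>i\<in>I. m i))"
      unfolding m_def
      using integral_sum_poisson_squared[OF I z A disj st]
      by (intro mult_mono h2_series_sum_le[OF F] suminf_nonneg) (use F in \<open>auto simp: h2_series_def\<close>)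
    finally show ?thesis .
  qed
  show ?thesis
  proof (rule LIMSEQ_le_const2)
    show "(\<lambda>N. (\<Sum>i\<in>I. m i * cmod (circle_poly a N (z i)))\<^sup>2) \<longlonglongrightarrow> (\<Sum>i\<in>I. m i * cmod (F (z i)))\<^sup>2"
      by (intro tendsto_intros h2_series_poly_tendsto[OF F] z)
  qed (use le in auto)
qed

lemma open_cmod_diff_less: "open {t. cmod (z - t) < c}"
  by (intro open_Collect_less continuous_intros)

text \<open>A weak-type estimate for the non-tangential maximal function. Each point of
  \<open>E\<close> lies in the shadow of some \<open>z\<close> with \<open>cmod (F z) > s\<close>;
  countably many shadows suffice, and after they are made disjoint
  \<open>h2_series_weighted_sum\<close> applies to any finite number of them.\<close>

lemma h2_series_maximal:
  fixes \<alpha> :: real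
  assumes F: "h2_series a F" and s: "0 < s"
  defines "E \<equiv> {t \<in> sphere 0 1. \<exists>z\<in>stolz_region \<alpha> t. s < cmod (F z)}"
  shows "E \<in> sets circle_measure"
    and "measure circle_measure E \<le> 2 * (1 + \<alpha>)\<^sup>2 * (\<Sum>n. (cmod (a n))\<^sup>2) / s\<^sup>2"
proof -
  define V where "V = {z. cmod z < 1 \<and> s < cmod (F z)}"
  define S where "S z = {t. cmod (z - t) < \<alpha> * (1 - cmod z)}" for z
  have E: "E = (\<Union>z\<in>V. S z \<inter> sphere 0 1)"
    by (auto simp: E_def V_def S_def stolz_region_def)
  \<comment> \<open>The shadows are open in \<open>t\<close>, so the Lindelof property replaces the
    uncountable union by a countable one.\<close>
  obtain \<F> where \<F>: "\<F> \<subseteq> S ` V" "countable \<F>" "\<Union>\<F> = \<Union>(S ` V)"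
    by (rule Lindelof[of "S ` V"]) (auto simp: S_def open_cmod_diff_less)
  obtain V' where V': "countable V'" "V' \<subseteq> V" "\<F> = S ` V'"
    using \<F>(1,2) by (metis countable_subset_image)
  have E': "E = (\<Union>z\<in>V'. S z \<inter> sphere 0 1)"
    unfolding E using \<F>(3) V'(3) by blast
  have meas: "S z \<inter> sphere 0 1 \<in> sets circle_measure" for z
    by (intro open_Int_sphere_sets_circle) (simp add: S_def open_cmod_diff_less)
  show "E \<in> sets circle_measure"
    unfolding E' using V'(1) meas by (intro sets.countable_UN') auto
  show "measure circle_measure E \<le> 2 * (1 + \<alpha>)\<^sup>2 * (\<Sum>n. (cmod (a n))\<^sup>2) / s\<^sup>2"
  proof (cases "V' = {}")
    case True
    have "0 \<le> (\<Sum>n. (cmod (a n))\<^sup>2)" using F by (intro suminf_nonneg) (auto simp: h2_series_def)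
    then show ?thesis using E' True by simp
  next
    case False
    define z where "z = from_nat_into V'"
    have zV: "z i \<in> V" for i using from_nat_into[OF False] V'(2) by (auto simp: z_def)
    \<comment> \<open>Disjointing assigns to each point of \<open>E\<close> exactly one witness
      \<open>z i\<close>.\<close>
    define A where "A = disjointed (\<lambda>i. S (z i) \<inter> sphere 0 1)"
    have A: "range A \<subseteq> sets circle_measure"
      unfolding A_def by (rule sets.range_disjointed_sets) (use meas in auto)
    have disj: "disjoint_family A" unfolding A_def by (rule disjoint_family_disjointed)
    have UA: "(\<Union>i. A i) = E"
      unfolding A_def UN_disjointed_eq E' z_def
      by (subst (2) range_from_nat_into[OF False V'(1), symmetric]) simp
    define m where "m i = measure circle_measure (A i)" for i
    have m0: "0 \<le> m i" for i by (simp add: m_def)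
    let ?C = "2 * (1 + \<alpha>)\<^sup>2 * (\<Sum>n. (cmod (a n))\<^sup>2)"
    have le: "(\<Sum>i<n. m i) \<le> ?C / s\<^sup>2" for n
    proof -
      let ?M = "\<Sum>i<n. m i"
      have M0: "0 \<le> ?M" by (intro sum_nonneg m0)
      have "s * ?M \<le> (\<Sum>i<n. m i * cmod (F (z i)))"
        unfolding sum_distrib_left
        using zV m0
        by (intro sum_mono) (auto simp: V_def mult.commute[of s] intro!: mult_left_mono[OF less_imp_le])
      then have "(s * ?M)\<^sup>2 \<le> (\<Sum>i<n. m i * cmod (F (z i)))\<^sup>2"
        using s M0 by (intro power_mono) auto
      also have "\<dots> \<le> (\<Sum>n. (cmod (a n))\<^sup>2) * (2 * (1 + \<alpha>)\<^sup>2 * ?M)"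
        unfolding m_def
      proof (rule h2_series_weighted_sum[OF F])
        show "disjoint_family_on A {..<n}" using disj by (rule disjoint_family_on_mono[rotated]) simp
        fix i t assume "t \<in> A i"
        then have "t \<in> S (z i)" using disjointed_subset[of "\<lambda>i. S (z i) \<inter> sphere 0 1" i] by (auto simp: A_def)
        then show "z i \<in> stolz_region \<alpha> t" using zV[of i] by (auto simp: S_def stolz_region_def V_def)
      qed (use A zV in \<open>auto simp: V_def\<close>)
      \<comment> \<open>The left side is quadratic in the measure \<open>?M\<close> and the right
        side linear; cancelling one factor gives the weak-type bound.\<close>
      finally have "(s\<^sup>2 * ?M) * ?M \<le> ?C * ?M" by (simp add: power2_eq_square mult_ac)
      moreover have "0 \<le> ?C"
        using F by (intro mult_nonneg_nonneg suminf_nonneg) (auto simp: h2_series_def)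
      ultimately have "s\<^sup>2 * ?M \<le> ?C" using M0 by (cases "?M = 0") auto
      then show ?thesis using s by (simp add: field_simps)
    qed
    have "(\<lambda>n. \<Sum>i<n. m i) \<longlonglongrightarrow> measure circle_measure E"
      using circle.finite_measure_UNION[OF A disj] by (simp add: sums_def m_def UA)
    then show ?thesis by (rule LIMSEQ_le_const2) (use le in auto)
  qed
qed

section \<open>Existence and uniqueness of non-tangential limits\<close>

lemma ex_nt_limitI_cauchy:
  fixes F :: "complex \<Rightarrow> complex"
  assumes t: "cmod t = 1"
    and cauchy: "\<And>k n. \<exists>d>0. \<forall>z\<in>stolz_region (real n) t \<inter> ball t d.
      \<forall>w\<in>stolz_region (real n) t \<inter> ball t d. cmod (F z - F w) \<le> 1 / real (Suc k)"
  shows "\<exists>l. nt_limit F t l"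
proof -
  define r where "r j = complex_of_real (1 - 1 / real (j + 2)) * t" for j
  have rj: "cmod (r j) = 1 - 1 / real (j + 2)" for j
    using t by (simp only: r_def norm_mult norm_of_real) (simp add: field_simps)
  have rt: "cmod (r j - t) = 1 / real (j + 2)" for j
  proof -
    have "r j - t = complex_of_real (- (1 / real (j + 2))) * t" by (simp add: r_def algebra_simps)
    then show ?thesis using t by (simp only: norm_mult norm_of_real) (simp add: field_simps)
  qed
  \<comment> \<open>On a radius the distance to \<open>t\<close> equals
    \<open>1 - cmod (r j)\<close>, so every aperture above 1 admits these points, and 2 is the first
    such integer.\<close>
  have rs: "r j \<in> stolz_region (real n) t" if "n \<ge> 2" for j n
  proof -
    have "1 * (1 / real (j + 2)) < real n * (1 / real (j + 2))"
      using that by (intro mult_strict_right_mono) auto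
    then show ?thesis by (auto simp: stolz_region_def rj rt simp del: of_nat_add)
  qed
  have rlim: "\<forall>\<^sub>F j in sequentially. r j \<in> ball t d" if "d > 0" for d
  proof -
    have "(\<lambda>j. 1 / real (j + 2)) \<longlonglongrightarrow> 0" by real_asymp
    from order_tendstoD(2)[OF this that] show ?thesis
      by eventually_elim (simp only: mem_ball dist_norm norm_minus_commute[of t] rt)
  qed
  have "Cauchy (\<lambda>j. F (r j))"
  proof (rule metric_CauchyI)
    fix e :: real assume "e > 0"
    then obtain k where k: "1 / real (Suc k) < e" by (metis nat_approx_posE)
    obtain d where d: "d > 0" "\<forall>z\<in>stolz_region (real 2) t \<inter> ball t d.
      \<forall>w\<in>stolz_region (real 2) t \<inter> ball t d. cmod (F z - F w) \<le> 1 / real (Suc k)"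
      using cauchy[where n = 2 and k = k] by blast
    obtain J where "\<And>j. j \<ge> J \<Longrightarrow> r j \<in> ball t d"
      using rlim[OF d(1)] by (auto simp: eventually_sequentially)
    then have "dist (F (r i)) (F (r j)) < e" if "i \<ge> J" "j \<ge> J" for i j
      using d(2) rs[of 2] that k unfolding dist_norm by (intro le_less_trans[OF _ k]) blast
    then show "\<exists>M. \<forall>m\<ge>M. \<forall>n\<ge>M. dist (F (r m)) (F (r n)) < e" by blast
  qed
  then obtain l where l: "(\<lambda>j. F (r j)) \<longlonglongrightarrow> l"
    using Cauchy_convergent convergent_def by blast
  have "(F \<longlongrightarrow> l) (at t within stolz_region \<alpha> t)" for \<alpha>
  proof (rule tendstoI)
    fix e :: real assume "e > 0"
    then obtain k where k: "1 / real (Suc k) < e" by (metis nat_approx_posE)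
    \<comment> \<open>An integer aperture that dominates \<open>\<alpha>\<close> and whose region
      also contains the radial points.\<close>
    obtain n :: nat where n: "n \<ge> 2" "\<alpha> \<le> real n"
      by (metis linear nat_le_real_less order_trans real_arch_simple max.cobounded1 max.cobounded2 of_nat_le_iff)
    have sub: "stolz_region \<alpha> t \<subseteq> stolz_region (real n) t"
      using n(2) by (auto simp: stolz_region_def intro: less_le_trans mult_right_mono)
    obtain d where d: "d > 0" "\<forall>z\<in>stolz_region (real n) t \<inter> ball t d.
      \<forall>w\<in>stolz_region (real n) t \<inter> ball t d. cmod (F z - F w) \<le> 1 / real (Suc k)"
      using cauchy by blast
    have "dist (F z) l < e" if z: "z \<in> stolz_region \<alpha> t" "dist z t < d" for z
    proof -
      \<comment> \<open>The Cauchy estimate compares \<open>z\<close> with the radial points, which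
        tend to \<open>t\<close>; hence the radial limit \<open>l\<close> is the limit for every
        aperture.\<close>
      have "dist (F z) l \<le> 1 / real (Suc k)"
      proof (rule tendsto_upperbound)
        show "((\<lambda>j. dist (F z) (F (r j))) \<longlongrightarrow> dist (F z) l) sequentially"
          by (intro tendsto_intros l)
        show "\<forall>\<^sub>F j in sequentially. dist (F z) (F (r j)) \<le> 1 / real (Suc k)"
          using rlim[OF d(1)]
          by eventually_elim (use d(2) rs[OF n(1)] sub z in \<open>auto simp: dist_norm norm_minus_commute\<close>)
      qed simp
      then show ?thesis using k by simp
    qed
    then show "\<forall>\<^sub>F x in at t within stolz_region \<alpha> t. dist (F x) l < e"
      unfolding eventually_at using d(1) by blast
  qed
  then show ?thesis by (auto simp: nt_limit_def)
qed

text \<open>Integer apertures \<open>n\<close>, thresholds \<open>1 / Suc k\<close> and scales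
  \<open>1 / Suc j\<close> make the failure of a non-tangential limit a countable combination of
  sets.\<close>

definition nt_oscillation :: "(complex \<Rightarrow> complex) \<Rightarrow> nat \<Rightarrow> nat \<Rightarrow> complex set" where
  "nt_oscillation F n k = {t \<in> sphere 0 1. \<forall>j. \<exists>z\<in>stolz_region (real n) t \<inter> ball t (1 / real (Suc j)).
      \<exists>w\<in>stolz_region (real n) t \<inter> ball t (1 / real (Suc j)). 1 / real (Suc k) < cmod (F z - F w)}"

text \<open>For fixed witnesses \<open>z\<close> and \<open>w\<close> the conditions on
  \<open>t\<close> are open, so the union over all witnesses is open; the quantifier over
  \<open>j\<close> is a countable intersection.\<close>

lemma nt_oscillation_sets: "nt_oscillation F n k \<in> sets circle_measure"
proof -
  let ?S = "\<lambda>j z. {t. cmod (z - t) < real n * (1 - cmod z)} \<inter> ball z (1 / real (Suc j))"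
  let ?V = "{(z, w). cmod z < 1 \<and> cmod w < 1 \<and> 1 / real (Suc k) < cmod (F z - F w)}"
  have eq: "nt_oscillation F n k = (\<Inter>j. (\<Union>(z, w)\<in>?V. ?S j z \<inter> ?S j w) \<inter> sphere 0 1)"
    by (rule set_eqI) (auto simp: nt_oscillation_def stolz_region_def Bex_def dist_commute; blast)
  have "(\<Union>(z, w)\<in>?V. ?S j z \<inter> ?S j w) \<inter> sphere 0 1 \<in> sets circle_measure" for j
    by (intro open_Int_sphere_sets_circle) (auto intro!: open_UN open_Int open_cmod_diff_less)
  then show ?thesis unfolding eq by (intro sets.countable_INT' image_subsetI) simp_all
qed

lemma ex_nt_limit_iff:
  assumes t: "cmod t = 1"
  shows "(\<exists>l. nt_limit F t l) \<longleftrightarrow> (\<forall>n k. t \<notin> nt_oscillation F n k)"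
proof
  assume "\<exists>l. nt_limit F t l"
  then obtain l where l: "nt_limit F t l" ..
  show "\<forall>n k. t \<notin> nt_oscillation F n k"
  proof (intro allI notI)
    fix n k assume osc: "t \<in> nt_oscillation F n k"
    \<comment> \<open>\<open>nt_limit\<close> speaks only of apertures above 1, while
      \<open>n\<close> may be 0 or 1. Enlarging the aperture by 2 covers these cases, and the larger
      region contains the original one.\<close>
    have "(F \<longlongrightarrow> l) (at t within stolz_region (real n + 2) t)" using l by (simp add: nt_limit_def)
    moreover have "1 / real (Suc k) / 2 > 0" by simp
    ultimately have "\<forall>\<^sub>F z in at t within stolz_region (real n + 2) t. dist (F z) l < 1 / real (Suc k) / 2"
      by (rule tendstoD)
    then obtain d where d: "d > 0" "\<And>z. z \<in> stolz_region (real n + 2) t \<Longrightarrow> z \<noteq> t \<Longrightarrow> dist z t < d \<Longrightarrow>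
        dist (F z) l < 1 / real (Suc k) / 2"
      unfolding eventually_at by blast
    have sub: "z \<in> stolz_region (real n + 2) t \<and> z \<noteq> t" if "z \<in> stolz_region (real n) t" for z
      using that t by (auto simp: stolz_region_def algebra_simps)
    obtain j where j: "1 / real (Suc j) < d" using d(1) by (metis nat_approx_posE)
    obtain z w where z: "z \<in> stolz_region (real n) t" "dist t z < 1 / real (Suc j)"
      and w: "w \<in> stolz_region (real n) t" "dist t w < 1 / real (Suc j)"
      and zw: "1 / real (Suc k) < cmod (F z - F w)"
      using osc unfolding nt_oscillation_def by fastforce
    have "dist (F z) l < 1 / real (Suc k) / 2" "dist (F w) l < 1 / real (Suc k) / 2"
      using d(2)[of z] d(2)[of w] sub[OF z(1)] sub[OF w(1)] z(2) w(2) j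
      by (simp_all only: dist_commute[of t]) (meson less_trans)+
    then have "dist (F z) (F w) < 1 / real (Suc k)" by (rule dist_triangle_half_l)
    then show False using zw by (simp add: dist_norm)
  qed
next
  assume no: "\<forall>n k. t \<notin> nt_oscillation F n k"
  show "\<exists>l. nt_limit F t l"
  proof (rule ex_nt_limitI_cauchy[OF t])
    fix k n
    obtain j where "\<forall>z\<in>stolz_region (real n) t \<inter> ball t (1 / real (Suc j)).
      \<forall>w\<in>stolz_region (real n) t \<inter> ball t (1 / real (Suc j)). \<not> 1 / real (Suc k) < cmod (F z - F w)"
      using no[rule_format, of n k] t unfolding nt_oscillation_def by auto
    then show "\<exists>d>0. \<forall>z\<in>stolz_region (real n) t \<inter> ball t d.
      \<forall>w\<in>stolz_region (real n) t \<inter> ball t d. cmod (F z - F w) \<le> 1 / real (Suc k)"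
      by (intro exI[of _ "1 / real (Suc j)"]) (auto simp: not_less)
  qed
qed

text \<open>One fixed radial sequence is enough to make the limit unique, and it exhibits boundary
  functions as pointwise limits of dilates.\<close>

lemma nt_limit_radial:
  assumes t: "cmod t = 1" and l: "nt_limit F t l"
  shows "(\<lambda>j. F (of_real (1 - 1 / real (j + 2)) * t)) \<longlonglongrightarrow> l"
proof -
  let ?r = "\<lambda>j. of_real (1 - 1 / real (j + 2)) * t"
  have lim: "(F \<longlongrightarrow> l) (at t within stolz_region 2 t)" using l by (simp add: nt_limit_def)
  have rt: "cmod (?r j - t) = 1 / real (j + 2)" for j
  proof -
    have "?r j - t = complex_of_real (- (1 / real (j + 2))) * t" by (simp add: algebra_simps)
    then show ?thesis using t by (simp only: norm_mult norm_of_real) (simp add: field_simps)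
  qed
  have rj: "cmod (?r j) = 1 - 1 / real (j + 2)" for j
    using t by (simp only: norm_mult norm_of_real) (simp add: field_simps)
  have "filterlim ?r (at t within stolz_region 2 t) sequentially"
    unfolding filterlim_at
  proof
    show "\<forall>\<^sub>F j in sequentially. ?r j \<in> stolz_region 2 t \<and> ?r j \<noteq> t"
    proof (rule always_eventually, rule allI, rule conjI)
      fix j
      have "1 * (1 / real (j + 2)) < 2 * (1 / real (j + 2))"
        by (intro mult_strict_right_mono) auto
      then show "?r j \<in> stolz_region 2 t"
        unfolding stolz_region_def by (simp only: mem_Collect_eq mem_ball dist_norm rt diff_0 norm_minus_cancel rj) simp
      show "?r j \<noteq> t" using rt[of j] by auto
    qed
    have "(\<lambda>j. ?r j - t) \<longlonglongrightarrow> 0"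
      by (rule tendsto_norm_zero_cancel, unfold rt) real_asymp
    then show "?r \<longlonglongrightarrow> t" by (rule Lim_transform[rotated]) simp
  qed
  then show ?thesis using lim by (rule filterlim_compose[rotated])
qed

lemma nt_limit_unique: "cmod t = 1 \<Longrightarrow> nt_limit F t l \<Longrightarrow> nt_limit F t l' \<Longrightarrow> l = l'"
  using nt_limit_radial LIMSEQ_unique by blast

lemma boundary_value_eq: "cmod t = 1 \<Longrightarrow> nt_limit F t l \<Longrightarrow> boundary_value F t = l"
  unfolding boundary_value_def by (blast intro: the_equality nt_limit_unique)

section \<open>Boundary values and the Riesz projection\<close>

lemma nt_limit_diff_continuous:
  assumes l: "nt_limit F t l" and c: "continuous_on UNIV g"
  shows "nt_limit (\<lambda>z. F z - g z) t (l - g t)"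
  unfolding nt_limit_def
proof (intro allI impI tendsto_diff)
  fix \<alpha> :: real assume "1 < \<alpha>"
  then show "(F \<longlongrightarrow> l) (at t within stolz_region \<alpha> t)" using l by (simp add: nt_limit_def)
  have "(g \<longlongrightarrow> g t) (at t)" using c by (simp add: continuous_on_def)
  then show "(g \<longlongrightarrow> g t) (at t within stolz_region \<alpha> t)" by (rule tendsto_within_subset) simp
qed

lemma ex_nt_limit_sets: "{t \<in> sphere 0 1. \<exists>l. nt_limit F t l} \<in> sets circle_measure"
proof -
  have eq: "{t \<in> sphere 0 1. \<exists>l. nt_limit F t l} = space circle_measure - (\<Union>n. \<Union>k. nt_oscillation F n k)"
    by (rule set_eqI) (simp add: ex_nt_limit_iff cong: conj_cong)
  show ?thesis
    unfolding eq by (intro sets.compl_sets sets.countable_UN image_subsetI nt_oscillation_sets)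
qed

lemma boundary_value_measurable:
  assumes "continuous_on (ball 0 1) F"
  shows "boundary_value F \<in> borel_measurable circle_measure"
proof -
  define D where "D = {t \<in> sphere 0 1. \<exists>l. nt_limit F t l}"
  let ?r = "\<lambda>j. of_real (1 - 1 / real (j + 2)) :: complex"
  have D [measurable]: "D \<in> sets circle_measure"
    unfolding D_def by (rule ex_nt_limit_sets)
  have r: "cmod (?r j) < 1" for j
    by (simp only: norm_of_real) simp
  have F [measurable]: "(\<lambda>t. F (?r j * t)) \<in> borel_measurable circle_measure" for j
    using r[of j]
    by (intro borel_measurable_circleI continuous_on_compose2[OF assms] continuous_intros)
       (auto simp only: mem_sphere_0 mem_ball_0 norm_mult mult_1_right)
  \<comment> \<open>Off \<open>D\<close> no limit exists, so the definite description in
    \<open>boundary_value\<close> has an unsatisfiable predicate and equals the constant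
    \<open>THE l. False\<close>.\<close>
  have "(\<lambda>t. if t \<in> D then boundary_value F t else (THE l. False)) \<in> borel_measurable circle_measure"
  proof (rule borel_measurable_LIMSEQ_metric)
    show "(\<lambda>t. if t \<in> D then F (?r j * t) else (THE l. False)) \<in> borel_measurable circle_measure" for j
      by measurable
    fix t assume t: "t \<in> space circle_measure"
    show "(\<lambda>j. if t \<in> D then F (?r j * t) else (THE l. False)) \<longlonglongrightarrow>
        (if t \<in> D then boundary_value F t else (THE l. False))"
    proof (cases "t \<in> D")
      case True
      then obtain l where "nt_limit F t l" by (auto simp: D_def)
      then show ?thesis using True t nt_limit_radial[of t F l] boundary_value_eq[of t F l] by simp
    qed simp
  qed
  also have "?this \<longleftrightarrow> ?thesis"
  proof (rule measurable_cong)
    fix t assume "t \<in> space circle_measure"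
    then have "\<And>l. \<not> nt_limit F t l" if "t \<notin> D" using that by (auto simp: D_def)
    then show "(if t \<in> D then boundary_value F t else (THE l. False)) = boundary_value F t"
      by (auto simp: boundary_value_def)
  qed
  finally show ?thesis .
qed

text \<open>A polynomial does not oscillate, so only the tail of the series contributes, and the maximal
  inequality makes this contribution small off a set of small measure.\<close>

lemma h2_series_nt_oscillation_null:
  assumes F: "h2_series a F"
  shows "nt_oscillation F n k \<in> null_sets circle_measure"
proof -
  let ?e = "1 / real (Suc k)"
  define S where "S N = (\<Sum>n. (cmod (if n < N then 0 else a n))\<^sup>2)" for N
  let ?C = "2 * (1 + real n)\<^sup>2"
  have le: "measure circle_measure (nt_oscillation F n k) \<le> ?C * S N / (?e / 3)\<^sup>2" for N
  proof -
    let ?Q = "circle_poly a N"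
    let ?G = "\<lambda>z. F z - ?Q z"
    let ?E = "{t \<in> sphere 0 1. \<exists>z\<in>stolz_region (real n) t. ?e / 3 < cmod (?G z)}"
    have sub: "nt_oscillation F n k \<subseteq> ?E"
    proof
      fix t assume t: "t \<in> nt_oscillation F n k"
      have "isCont ?Q t"
        using continuous_on_circle_poly[of UNIV a N] continuous_on_eq_continuous_at[of UNIV] by auto
      then obtain d where d: "d > 0" "\<And>z. dist z t < d \<Longrightarrow> dist (?Q z) (?Q t) < (?e / 3) / 2"
        unfolding continuous_at_eps_delta by (metis divide_pos_pos of_nat_0_less_iff zero_less_Suc zero_less_numeral zero_less_one)
      obtain j where j: "1 / real (Suc j) < d" using d(1) by (metis nat_approx_posE)
      obtain z w where z: "z \<in> stolz_region (real n) t" "dist t z < 1 / real (Suc j)"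
        and w: "w \<in> stolz_region (real n) t" "dist t w < 1 / real (Suc j)"
        and zw: "?e < cmod (F z - F w)"
        using t unfolding nt_oscillation_def by fastforce
      \<comment> \<open>An oscillation above \<open>?e\<close>, of which less than a third comes
        from the polynomial, leaves more than a third to the tail at \<open>z\<close> or at
        \<open>w\<close>.\<close>
      have split: "e / 3 < x \<or> e / 3 < y" if "d < e / 3" "c \<le> d + x + y" "e < c" for c d e x y :: real
        using that by linarith
      have "dist (?Q z) (?Q w) < ?e / 3"
        using z(2) w(2) j by (intro dist_triangle_half_l[OF d(2) d(2)]) (simp_all add: dist_commute)
      moreover have "cmod (F z - F w) \<le> dist (?Q z) (?Q w) + cmod (?G z) + cmod (?G w)"
        using norm_triangle_ineq4[of "?Q z - ?Q w + ?G z" "?G w"] norm_triangle_ineq[of "?Q z - ?Q w" "?G z"]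
        by (simp add: dist_norm)
      ultimately have "?e / 3 < cmod (?G z) \<or> ?e / 3 < cmod (?G w)"
        using zw split by blast
      moreover have "t \<in> sphere 0 1" using t by (simp add: nt_oscillation_def)
      ultimately show "t \<in> ?E" using z(1) w(1) by blast
    qed
    note m = h2_series_maximal[OF h2_series_tail[OF F, of N], of "?e / 3" "real n"]
    have "measure circle_measure (nt_oscillation F n k) \<le> measure circle_measure ?E"
      using m(1) by (intro circle.finite_measure_mono sub) simp
    also have "\<dots> \<le> ?C * S N / (?e / 3)\<^sup>2" unfolding S_def by (rule m(2)) simp
    finally show ?thesis .
  qed
  have "(\<lambda>N. ?C * S N / (?e / 3)\<^sup>2) \<longlonglongrightarrow> ?C * 0 / (?e / 3)\<^sup>2"
    unfolding S_def by (intro tendsto_intros h2_series_tail_tendsto_0[OF F]) simp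
  then have "measure circle_measure (nt_oscillation F n k) \<le> ?C * 0 / (?e / 3)\<^sup>2"
    by (rule LIMSEQ_le_const) (use le in auto)
  then have "measure circle_measure (nt_oscillation F n k) = 0"
    using measure_nonneg[of circle_measure "nt_oscillation F n k"] by simp
  then show ?thesis
    using nt_oscillation_sets by (intro null_setsI) (simp add: circle.emeasure_eq_measure)
qed

text \<open>Fatou's theorem: the exceptional set is the countable union of the null sets
  \<open>nt_oscillation F n k\<close>.\<close>

theorem h2_series_ex_nt_limit:
  assumes F: "h2_series a F"
  shows "AE t in circle_measure. \<exists>l. nt_limit F t l"
proof -
  have "AE t in circle_measure. \<forall>n k. t \<notin> nt_oscillation F n k"
    unfolding AE_all_countable by (intro allI AE_not_in h2_series_nt_oscillation_null[OF F])
  moreover have "AE t in circle_measure. t \<in> space circle_measure" by (rule AE_space)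
  ultimately show ?thesis by eventually_elim (simp add: ex_nt_limit_iff)
qed

lemma AE_circle_norm: "AE t in circle_measure. cmod t = 1"
  using AE_space[of circle_measure] by simp

lemma h2_series_boundary_norm:
  assumes F: "h2_series a F" and u: "u \<in> borel_measurable circle_measure"
    and lim: "AE t in circle_measure. nt_limit F t (u t)"
  shows "u \<in> L2_circle" "(l2_norm u)\<^sup>2 \<le> (\<Sum>n. (cmod (a n))\<^sup>2)"
proof -
  let ?f = "\<lambda>j t. F (of_real (1 - 1 / real (j + 2)) * t)"
  have r: "0 \<le> 1 - 1 / real (j + 2)" "1 - 1 / real (j + 2) < 1" for j by auto
  have l: "AE t in circle_measure. (\<lambda>j. ?f j t) \<longlonglongrightarrow> u t"
    using lim AE_circle_norm by eventually_elim (rule nt_limit_radial)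
  note d = h2_series_dilate[OF F r]
  note * = L2_circle_fatou[OF L2_circleD[OF d(1)] u l d]
  show "u \<in> L2_circle" "(l2_norm u)\<^sup>2 \<le> (\<Sum>n. (cmod (a n))\<^sup>2)"
    unfolding l2_norm_sq by (rule *)+
qed

text \<open>The difference is the boundary function of a tail, so
  \<open>h2_series_boundary_norm\<close> bounds its norm by tail coefficients. This links the
  boundary function to the Taylor coefficients.\<close>

lemma h2_series_poly_norm_tendsto:
  assumes F: "h2_series a F" and u: "u \<in> borel_measurable circle_measure"
    and lim: "AE t in circle_measure. nt_limit F t (u t)"
  shows "(\<lambda>N. l2_norm (\<lambda>t. u t - circle_poly a N t)) \<longlonglongrightarrow> 0"
proof -
  have le: "(l2_norm (\<lambda>t. u t - circle_poly a N t))\<^sup>2 \<le> (\<Sum>n. (cmod (if n < N then 0 else a n))\<^sup>2)" for N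
  proof (rule h2_series_boundary_norm(2)[OF h2_series_tail[OF F]])
    show "(\<lambda>t. u t - circle_poly a N t) \<in> borel_measurable circle_measure"
      using u L2_circleD[OF L2_circle_poly] by (intro borel_measurable_diff)
    show "AE t in circle_measure. nt_limit (\<lambda>z. F z - circle_poly a N z) t (u t - circle_poly a N t)"
      using lim by eventually_elim (intro nt_limit_diff_continuous continuous_on_circle_poly)
  qed
  have "(\<lambda>N. (l2_norm (\<lambda>t. u t - circle_poly a N t))\<^sup>2) \<longlonglongrightarrow> 0"
    by (rule tendsto_sandwich[OF _ _ tendsto_const h2_series_tail_tendsto_0[OF F]]) (simp_all add: le)
  from tendsto_real_sqrt[OF this] show ?thesis by simp
qed

lemma l2_inner_h2_series_sums:
  assumes h: "h \<in> L2_circle" and F: "h2_series a F" and u: "u \<in> borel_measurable circle_measure"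
    and lim: "AE t in circle_measure. nt_limit F t (u t)"
  shows "(\<lambda>n. cnj (a n) * l2_inner h (\<lambda>t. t ^ n)) sums l2_inner h u"
proof -
  have uL: "u \<in> L2_circle" by (rule h2_series_boundary_norm[OF F u lim])
  have "(\<lambda>N. l2_inner h u - l2_inner h (circle_poly a N)) \<longlonglongrightarrow> 0"
  proof (rule Lim_null_comparison)
    show "\<forall>\<^sub>F N in sequentially. norm (l2_inner h u - l2_inner h (circle_poly a N)) \<le>
        l2_norm h * l2_norm (\<lambda>t. u t - circle_poly a N t)"
      using l2_inner_norm_le[OF h L2_circle_diff[OF uL L2_circle_poly]]
      by (intro always_eventually allI) (simp add: l2_inner_diff_right[OF uL L2_circle_poly h])
    show "(\<lambda>N. l2_norm h * l2_norm (\<lambda>t. u t - circle_poly a N t)) \<longlonglongrightarrow> 0"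
      by (intro tendsto_mult_right_zero h2_series_poly_norm_tendsto[OF F u lim])
  qed
  from tendsto_diff[OF tendsto_const[of "l2_inner h u"] this]
  have "(\<lambda>N. l2_inner h (circle_poly a N)) \<longlonglongrightarrow> l2_inner h u" by simp
  then show ?thesis unfolding sums_def l2_inner_circle_poly_right[OF h] .
qed

lemma h2_series_coefficient:
  assumes F: "h2_series a F" and u: "u \<in> borel_measurable circle_measure"
    and lim: "AE t in circle_measure. nt_limit F t (u t)"
  shows "l2_inner u (\<lambda>t. t ^ n) = a n"
proof -
  have "(\<lambda>k. cnj (a k) * l2_inner (\<lambda>t. t ^ n) (\<lambda>t. t ^ k)) sums l2_inner (\<lambda>t. t ^ n) u"
    by (rule l2_inner_h2_series_sums[OF L2_circle_power F u lim])
  then have "(\<lambda>k. if k = n then cnj (a k) else 0) sums l2_inner (\<lambda>t. t ^ n) u"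
    by (rule back_subst[of "\<lambda>f. f sums _"]) (auto simp: l2_inner_power_power)
  then have "l2_inner (\<lambda>t. t ^ n) u = cnj (a n)"
    by (rule sums_unique2) (rule sums_single)
  then show ?thesis by (subst l2_inner_commute) simp
qed

lemma H2_circle_series:
  assumes "u \<in> H2_circle"
  obtains a F where "h2_series a F" "u \<in> L2_circle" "AE t in circle_measure. nt_limit F t (u t)"
  using assms H2_disc_series unfolding H2_circle_def by blast

lemma H2_circle_L2: "u \<in> H2_circle \<Longrightarrow> u \<in> L2_circle"
  by (simp add: H2_circle_def)

lemma H2_circle_orthogonal:
  assumes "h \<in> L2_circle" "\<And>n. l2_inner h (\<lambda>t. t ^ n) = 0" "u \<in> H2_circle"
  shows "l2_inner h u = 0"
proof -
  obtain a F where "h2_series a F" "u \<in> L2_circle" "AE t in circle_measure. nt_limit F t (u t)"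
    using assms(3) by (rule H2_circle_series)
  then have "(\<lambda>n. cnj (a n) * l2_inner h (\<lambda>t. t ^ n)) sums l2_inner h u"
    using assms(1) by (intro l2_inner_h2_series_sums) auto
  then show ?thesis using assms(2) by (simp add: sums_iff)
qed

text \<open>By Bessel's inequality the Fourier coefficients of \<open>h\<close> with nonnegative
  index define an \<open>h2_series\<close>. Fatou's theorem supplies its boundary function, which
  has the same coefficients, so \<open>h - p\<close> is orthogonal to all monomials.\<close>

lemma riesz_projection:
  assumes h: "h \<in> L2_circle"
  obtains p where "p \<in> H2_circle" "\<And>u. u \<in> H2_circle \<Longrightarrow> l2_inner (\<lambda>t. h t - p t) u = 0"
proof -
  define a where "a n = l2_inner h (\<lambda>t. t ^ n)" for n
  define F where "F z = (\<Sum>n. a n * z ^ n)" for z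
  have sq: "summable (\<lambda>n. (cmod (a n))\<^sup>2)"
    using l2_bessel[OF h] by (intro summableI_nonneg_bounded[where x = "(l2_norm h)\<^sup>2"]) (auto simp: a_def)
  have an: "cmod (a n) \<le> l2_norm h" for n
  proof (rule power2_le_imp_le)
    have "(cmod (a n))\<^sup>2 \<le> (\<Sum>k<Suc n. (cmod (a k))\<^sup>2)" by (intro member_le_sum) auto
    also have "\<dots> \<le> (l2_norm h)\<^sup>2" unfolding a_def by (rule l2_bessel[OF h])
    finally show "(cmod (a n))\<^sup>2 \<le> (l2_norm h)\<^sup>2" .
  qed simp
  have F: "h2_series a F"
    unfolding h2_series_def
  proof (intro conjI sq ballI)
    fix z :: complex assume "z \<in> ball 0 1"
    then have "summable (\<lambda>n. l2_norm h * cmod z ^ n)"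
      by (intro summable_mult summable_geometric) simp
    moreover have "norm (a n * z ^ n) \<le> l2_norm h * cmod z ^ n" for n
      unfolding norm_mult norm_power by (intro mult_right_mono an zero_le_power) simp
    ultimately have "summable (\<lambda>n. a n * z ^ n)"
      by (rule summable_comparison_test')
    then show "(\<lambda>n. a n * z ^ n) sums F z" by (simp add: F_def summable_sums)
  qed
  let ?p = "boundary_value F"
  have m: "?p \<in> borel_measurable circle_measure"
    by (intro boundary_value_measurable holomorphic_on_imp_continuous_on h2_series_holomorphic[OF F])
  have lim: "AE t in circle_measure. nt_limit F t (?p t)"
    using h2_series_ex_nt_limit[OF F] AE_circle_norm
    by eventually_elim (auto simp: boundary_value_eq)
  have pL: "?p \<in> L2_circle" by (rule h2_series_boundary_norm[OF F m lim])
  have pH: "?p \<in> H2_circle"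
    using pL lim h2_series_in_H2[OF F] by (auto simp: H2_circle_def)
  moreover have "l2_inner (\<lambda>t. h t - ?p t) u = 0" if "u \<in> H2_circle" for u
  proof (rule H2_circle_orthogonal[OF L2_circle_diff[OF h pL] _ that])
    show "l2_inner (\<lambda>t. h t - ?p t) (\<lambda>t. t ^ n) = 0" for n
      by (simp add: l2_inner_diff_left[OF h pL L2_circle_power] h2_series_coefficient[OF F m lim] a_def)
  qed
  ultimately show ?thesis by (rule that)
qed

section \<open>The Szego kernels, the reproducing kernels of the Hardy space\<close>

definition szego :: "complex \<Rightarrow> complex \<Rightarrow> complex" where
  "szego w t = 1 / (1 - cnj w * t)"

lemma szego_continuous_on:
  assumes "cmod w < 1"
  shows "continuous_on (cball 0 1) (szego w)"
  unfolding szego_def[abs_def] using assms one_minus_mult_nonzero[of "cnj w"]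
  by (intro continuous_intros) auto

lemma szego_holomorphic: "cmod w < 1 \<Longrightarrow> szego w holomorphic_on ball 0 1"
  unfolding szego_def[abs_def] using one_minus_mult_nonzero[of "cnj w"]
  by (intro holomorphic_intros) auto

lemma nt_limit_continuous:
  assumes "continuous_on (cball 0 1) g" "cmod t = 1"
  shows "nt_limit g t (g t)"
  unfolding nt_limit_def
proof (intro allI impI)
  fix \<alpha> :: real
  have "(g \<longlongrightarrow> g t) (at t within cball 0 1)" using assms by (simp add: continuous_on_def)
  then show "(g \<longlongrightarrow> g t) (at t within stolz_region \<alpha> t)"
    by (rule tendsto_within_subset) (auto simp: stolz_region_def)
qed

lemma szego_series:
  assumes "cmod w < 1"
  shows "h2_series (\<lambda>n. cnj w ^ n) (szego w)"
  unfolding h2_series_def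
proof
  have "summable (\<lambda>n. ((cmod w)\<^sup>2) ^ n)"
    using assms by (intro summable_geometric) (simp add: power_less_one_iff abs_square_less_1)
  then show "summable (\<lambda>n. (cmod (cnj w ^ n))\<^sup>2)"
    by (simp add: norm_power power_mult[symmetric] mult.commute)
  show "\<forall>z\<in>ball 0 1. (\<lambda>n. cnj w ^ n * z ^ n) sums szego w z"
  proof
    fix z :: complex assume "z \<in> ball 0 1"
    then have "cmod (cnj w * z) < 1"
      using assms mult_strict_mono[of "cmod w" 1 "cmod z" 1] by (simp add: norm_mult)
    from geometric_sums[OF this] show "(\<lambda>n. cnj w ^ n * z ^ n) sums szego w z"
      by (simp add: szego_def power_mult_distrib)
  qed
qed

lemma szego_L2: "cmod w < 1 \<Longrightarrow> szego w \<in> L2_circle"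
  by (intro L2_circle_continuous continuous_on_subset[OF szego_continuous_on]) auto

lemma szego_nt_limit: "cmod w < 1 \<Longrightarrow> AE t in circle_measure. nt_limit (szego w) t (szego w t)"
  using AE_circle_norm by eventually_elim (intro nt_limit_continuous szego_continuous_on)

lemma szego_H2: "cmod w < 1 \<Longrightarrow> szego w \<in> H2_circle"
  unfolding H2_circle_def using szego_L2 szego_nt_limit h2_series_in_H2[OF szego_series] by blast

text \<open>The Fourier coefficients of \<open>u\<close> are the Taylor coefficients of
  \<open>F\<close>, and those of the kernel are \<open>cnj w ^ n\<close>; the inner product is
  therefore the Taylor series of \<open>F\<close> at \<open>w\<close>.\<close>

lemma szego_reproducing:
  assumes w: "cmod w < 1" and u: "u \<in> L2_circle" and F: "F \<in> H2_disc"
    and lim: "AE t in circle_measure. nt_limit F t (u t)"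
  shows "l2_inner u (szego w) = F w"
proof -
  obtain a where a: "h2_series a F" using F by (rule H2_disc_series)
  have "(\<lambda>n. cnj (cnj w ^ n) * l2_inner u (\<lambda>t. t ^ n)) sums l2_inner u (szego w)"
    by (rule l2_inner_h2_series_sums[OF u szego_series[OF w] L2_circleD[OF szego_L2[OF w]] szego_nt_limit[OF w]])
  then have "(\<lambda>n. a n * w ^ n) sums l2_inner u (szego w)"
    by (simp add: h2_series_coefficient[OF a L2_circleD[OF u] lim] mult.commute)
  moreover have "(\<lambda>n. a n * w ^ n) sums F w" using a w by (simp add: h2_series_def)
  ultimately show ?thesis by (rule sums_unique2)
qed

section \<open>Model spaces\<close>

lemma nt_limit_mult:
  "nt_limit F t l \<Longrightarrow> nt_limit G t l' \<Longrightarrow> nt_limit (\<lambda>z. F z * G z) t (l * l')"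
  unfolding nt_limit_def by (auto intro: tendsto_mult)

lemma nt_limit_diff:
  "nt_limit F t l \<Longrightarrow> nt_limit G t l' \<Longrightarrow> nt_limit (\<lambda>z. F z - G z) t (l - l')"
  unfolding nt_limit_def by (auto intro: tendsto_diff)

lemma nt_limit_const: "nt_limit (\<lambda>z. c) t c"
  unfolding nt_limit_def by auto

lemma H2_discI_bounded_mult:
  assumes "F \<in> Hinf_disc" "G \<in> H2_disc"
  shows "(\<lambda>z. F z * G z) \<in> H2_disc"
proof -
  obtain B where B: "\<forall>z\<in>ball 0 1. cmod (F z) \<le> B"
    using assms(1) by (auto simp: Hinf_disc_def bounded_iff)
  have F: "F holomorphic_on ball 0 1" and G: "G holomorphic_on ball 0 1"
    using assms by (auto simp: Hinf_disc_def H2_disc_def)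
  obtain K where K: "\<forall>r\<in>{0..<1}. (\<integral>t. (cmod (G (of_real r * t)))\<^sup>2 \<partial>circle_measure) \<le> K"
    using assms(2) by (auto simp: H2_disc_def bdd_above_def)
  have "(\<integral>t. (cmod (F (of_real r * t) * G (of_real r * t)))\<^sup>2 \<partial>circle_measure) \<le> B\<^sup>2 * K"
    if r: "r \<in> {0..<1}" for r
  proof -
    have c: "continuous_on (sphere 0 1) (\<lambda>t. H (of_real r * t))" if "H holomorphic_on ball 0 1" for H :: "complex \<Rightarrow> complex"
      using r by (intro continuous_on_compose2[OF holomorphic_on_imp_continuous_on[OF that]] continuous_intros)
        (auto simp: norm_mult)
    have "(\<integral>t. (cmod (F (of_real r * t) * G (of_real r * t)))\<^sup>2 \<partial>circle_measure) \<le>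
        (\<integral>t. B\<^sup>2 * (cmod (G (of_real r * t)))\<^sup>2 \<partial>circle_measure)"
    proof (intro integral_mono circle_integrable_continuous continuous_intros c F G)
      fix t assume "t \<in> space circle_measure"
      then have "cmod (F (of_real r * t)) \<le> B" using r B by (auto simp: norm_mult)
      then show "(cmod (F (of_real r * t) * G (of_real r * t)))\<^sup>2 \<le> B\<^sup>2 * (cmod (G (of_real r * t)))\<^sup>2"
        by (auto simp: norm_mult power_mult_distrib intro!: mult_right_mono power_mono)
    qed
    also have "\<dots> \<le> B\<^sup>2 * K" using K r by (auto intro!: mult_left_mono)
    finally show ?thesis .
  qed
  then show ?thesis
    unfolding H2_disc_def using F G by (auto intro!: holomorphic_intros bdd_aboveI2[where M = "B\<^sup>2 * K"])
qed

lemma H2_disc_diff: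
  assumes "F \<in> H2_disc" "G \<in> H2_disc"
  shows "(\<lambda>z. F z - G z) \<in> H2_disc"
proof -
  obtain a b where a: "h2_series a F" and b: "h2_series b G"
    using assms H2_disc_series by metis
  have le: "(cmod (x - y))\<^sup>2 \<le> 2 * (cmod x)\<^sup>2 + 2 * (cmod y)\<^sup>2" for x y
  proof -
    have "(cmod (x - y))\<^sup>2 \<le> (cmod x + cmod y)\<^sup>2"
      by (intro power_mono norm_triangle_ineq4) auto
    then show ?thesis
      using sum_squares_bound[of "cmod x" "cmod y"] by (simp add: power2_sum)
  qed
  have "summable (\<lambda>n. 2 * (cmod (a n))\<^sup>2 + 2 * (cmod (b n))\<^sup>2)"
    using a b by (intro summable_add summable_mult) (auto simp: h2_series_def)
  then have "summable (\<lambda>n. (cmod (a n - b n))\<^sup>2)"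
    by (rule summable_comparison_test'[of _ 0]) (simp add: le)
  then have "h2_series (\<lambda>n. a n - b n) (\<lambda>z. F z - G z)"
    using a b by (auto simp: h2_series_def left_diff_distrib intro!: sums_diff)
  then show ?thesis by (rule h2_series_in_H2)
qed

lemma H2_circle_diff:
  assumes "f \<in> H2_circle" "g \<in> H2_circle"
  shows "(\<lambda>t. f t - g t) \<in> H2_circle"
proof -
  obtain F G where "F \<in> H2_disc" "G \<in> H2_disc"
    and F: "AE t in circle_measure. nt_limit F t (f t)" and G: "AE t in circle_measure. nt_limit G t (g t)"
    using assms by (auto simp: H2_circle_def)
  moreover have "AE t in circle_measure. nt_limit (\<lambda>z. F z - G z) t (f t - g t)"
    using F G by eventually_elim (rule nt_limit_diff)
  ultimately show ?thesis
    using assms H2_disc_diff L2_circle_diff unfolding H2_circle_def by blast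
qed

lemma Hinf_disc_H2_disc:
  assumes "F \<in> Hinf_disc"
  shows "F \<in> H2_disc"
proof -
  have "(\<lambda>z. 1) \<in> H2_disc" by (auto simp: H2_disc_def bdd_above_def)
  from H2_discI_bounded_mult[OF assms this] show ?thesis by simp
qed

lemma nt_limit_cmult: "nt_limit F t l \<Longrightarrow> nt_limit (\<lambda>z. c * F z) t (c * l)"
  by (intro nt_limit_mult nt_limit_const)

text \<open>Used to normalise the kernel without leaving the domain of the operator.\<close>

lemma model_space_inf_mult:
  assumes "f \<in> model_space_inf \<Theta>"
  shows "(\<lambda>t. c * f t) \<in> model_space_inf \<Theta>"
proof -
  obtain F G where F: "F \<in> Hinf_disc" "AE t in circle_measure. nt_limit F t (f t)"
    and G: "G \<in> H2_disc" "AE t in circle_measure. nt_limit G t (f t)"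
    and f: "f \<in> L2_circle" "\<And>g. g \<in> H2_circle \<Longrightarrow> l2_inner f (\<lambda>z. boundary_value \<Theta> z * g z) = 0"
    using assms by (auto simp: model_space_inf_def Hinf_circle_def model_space_def H2_circle_def)
  have c: "(\<lambda>z. c) \<in> Hinf_disc" by (auto simp: Hinf_disc_def intro: bounded_subset[of "{c}"])
  obtain B where "\<forall>z\<in>ball 0 1. cmod (F z) \<le> B"
    using F(1) by (auto simp: Hinf_disc_def bounded_iff)
  then have "\<forall>z\<in>ball 0 1. cmod (c * F z) \<le> cmod c * B"
    by (auto simp: norm_mult intro!: mult_left_mono)
  then have "bounded ((\<lambda>z. c * F z) ` ball 0 1)"
    unfolding bounded_iff by blast
  then have "(\<lambda>z. c * F z) \<in> Hinf_disc"
    using F(1) by (simp add: Hinf_disc_def holomorphic_on_mult)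
  moreover have "AE t in circle_measure. nt_limit (\<lambda>z. c * F z) t (c * f t)"
    using F(2) by eventually_elim (rule nt_limit_cmult)
  moreover have "(\<lambda>z. c * G z) \<in> H2_disc" by (rule H2_discI_bounded_mult[OF c G(1)])
  moreover have "AE t in circle_measure. nt_limit (\<lambda>z. c * G z) t (c * f t)"
    using G(2) by eventually_elim (rule nt_limit_cmult)
  ultimately show ?thesis
    using f L2_circle_mult[OF f(1), of c]
    unfolding model_space_inf_def Hinf_circle_def model_space_def H2_circle_def
    by (auto simp: l2_inner_mult_left)
qed

text \<open>Radial limits inherit the bound of the disc function, so multiplying even an unbounded
  symbol by \<open>f\<close> stays in \<open>L2_circle\<close>.\<close>

lemma L2_circle_mult_Hinf:
  assumes "g \<in> L2_circle" "f \<in> model_space_inf \<Theta>"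
  shows "(\<lambda>t. g t * f t) \<in> L2_circle"
proof -
  obtain F where F: "F \<in> Hinf_disc" "AE t in circle_measure. nt_limit F t (f t)" and f: "f \<in> L2_circle"
    using assms(2) by (auto simp: model_space_inf_def Hinf_circle_def)
  obtain B where B: "\<forall>z\<in>ball 0 1. cmod (F z) \<le> B"
    using F(1) by (auto simp: Hinf_disc_def bounded_iff)
  have "AE t in circle_measure. cmod (f t) \<le> B"
    using F(2) AE_circle_norm
  proof eventually_elim
    case (elim t)
    show ?case
    proof (rule LIMSEQ_le_const2[OF tendsto_norm[OF nt_limit_radial[OF elim(2,1)]]], intro exI allI impI)
      fix j :: nat
      have "cmod (of_real (1 - 1 / real (j + 2)) * t) < 1"
        using elim(2) by (simp only: norm_mult norm_of_real) simp
      then show "cmod (F (of_real (1 - 1 / real (j + 2)) * t)) \<le> B" using B by simp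
    qed
  qed
  then show ?thesis
    using L2_circle_bounded_mult[OF assms(1) L2_circleD[OF f]] by (simp add: mult.commute)
qed

section \<open>Inner functions and the projection onto the model space\<close>

locale inner_fun =
  fixes \<Theta> :: "complex \<Rightarrow> complex"
  assumes inner: "inner_function \<Theta>" and nonconst: "\<not> \<Theta> constant_on ball 0 1"
begin

abbreviation "bv \<equiv> boundary_value \<Theta>"

lemma Hinf: "\<Theta> \<in> Hinf_disc"
  using inner by (simp add: inner_function_def)

lemma holomorphic: "\<Theta> holomorphic_on ball 0 1"
  using Hinf by (simp add: Hinf_disc_def)

lemma bv_measurable [measurable]: "bv \<in> borel_measurable circle_measure"
  by (intro boundary_value_measurable holomorphic_on_imp_continuous_on holomorphic)

lemma AE_bv: "AE t in circle_measure. nt_limit \<Theta> t (bv t) \<and> cmod (bv t) = 1"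
proof -
  have "AE t in circle_measure. \<exists>l. nt_limit \<Theta> t l \<and> cmod l = 1"
    using inner by (simp add: inner_function_def)
  then show ?thesis using AE_circle_norm by eventually_elim (auto simp: boundary_value_eq)
qed

lemma AE_cmod_bv: "AE t in circle_measure. cmod (bv t) = 1"
  using AE_bv by eventually_elim simp

lemma bv_mult_L2: "f \<in> L2_circle \<Longrightarrow> (\<lambda>t. bv t * f t) \<in> L2_circle"
  using AE_cmod_bv by (intro L2_circle_bounded_mult[where B = 1]) (auto elim: eventually_mono)

lemma cnj_bv_mult_L2: "f \<in> L2_circle \<Longrightarrow> (\<lambda>t. cnj (bv t) * f t) \<in> L2_circle"
  using AE_cmod_bv
  by (intro L2_circle_bounded_mult[where B = 1])
     (auto elim: eventually_mono intro!: borel_measurable_continuous_on[of cnj] continuous_intros)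

lemma bv_mult_H2:
  assumes "g \<in> H2_circle"
  shows "(\<lambda>t. bv t * g t) \<in> H2_circle"
proof -
  obtain G where G: "G \<in> H2_disc" "AE t in circle_measure. nt_limit G t (g t)"
    using assms by (auto simp: H2_circle_def)
  have "AE t in circle_measure. nt_limit (\<lambda>z. \<Theta> z * G z) t (bv t * g t)"
    using AE_bv G(2) by eventually_elim (auto intro: nt_limit_mult)
  then show ?thesis
    using assms H2_discI_bounded_mult[OF Hinf G(1)] bv_mult_L2 unfolding H2_circle_def by blast
qed

lemma l2_inner_bv_bv:
  "l2_inner (\<lambda>t. bv t * f t) (\<lambda>t. bv t * g t) = l2_inner f g"
  if [measurable]: "f \<in> borel_measurable circle_measure" "g \<in> borel_measurable circle_measure"
proof -
  have [measurable]: "(\<lambda>t. cnj (h t)) \<in> borel_measurable circle_measure"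
    if "h \<in> borel_measurable circle_measure" for h
    using that by (intro borel_measurable_continuous_on[of cnj] continuous_intros)
  show ?thesis
    unfolding l2_inner_def
  proof (rule integral_cong_AE)
    show "AE t in circle_measure. bv t * f t * cnj (bv t * g t) = f t * cnj (g t)"
      using AE_cmod_bv
    proof eventually_elim
      case (elim t)
      then have "bv t * cnj (bv t) = 1" by (simp add: complex_norm_square[symmetric])
      then show ?case by (simp add: mult_ac)
    qed
  qed auto
qed

lemma l2_inner_cnj_bv:
  "l2_inner (\<lambda>t. cnj (bv t) * f t) g = l2_inner f (\<lambda>t. bv t * g t)"
  unfolding l2_inner_def by (simp add: mult_ac)

lemma model_space_L2: "f \<in> model_space \<Theta> \<Longrightarrow> f \<in> L2_circle"
  by (simp add: model_space_def H2_circle_L2)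

text \<open>With \<open>P\<^sub>+\<close> the Riesz projection, the projection of \<open>h\<close> onto the model space is
  \<open>P\<^sub>+ h - \<Theta> P\<^sub>+ (cnj \<Theta> h)\<close>.\<close>

lemma model_projection_exists:
  assumes h: "h \<in> L2_circle"
  shows "\<exists>g. g \<in> model_space \<Theta> \<and> (\<forall>f\<in>model_space \<Theta>. l2_inner (\<lambda>t. h t - g t) f = 0)"
proof -
  obtain p where p: "p \<in> H2_circle" "\<And>u. u \<in> H2_circle \<Longrightarrow> l2_inner (\<lambda>t. h t - p t) u = 0"
    using riesz_projection[OF h] by blast
  obtain q where q: "q \<in> H2_circle"
    "\<And>u. u \<in> H2_circle \<Longrightarrow> l2_inner (\<lambda>t. cnj (bv t) * h t - q t) u = 0"
    using riesz_projection[OF cnj_bv_mult_L2[OF h]] by blast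
  note L2 = h H2_circle_L2[OF p(1)] H2_circle_L2[OF q(1)] bv_mult_L2 cnj_bv_mult_L2[OF h] L2_circle_diff
  have p': "l2_inner p u = l2_inner h u" if "u \<in> H2_circle" for u
    using p(2)[OF that] by (simp add: l2_inner_diff_left L2 H2_circle_L2 that)
  have q': "l2_inner q u = l2_inner h (\<lambda>t. bv t * u t)" if "u \<in> H2_circle" for u
    using q(2)[OF that] by (simp add: l2_inner_diff_left L2 H2_circle_L2 that l2_inner_cnj_bv)
  let ?g = "\<lambda>t. p t - bv t * q t"
  have gH: "?g \<in> H2_circle" by (intro H2_circle_diff bv_mult_H2 p(1) q(1))
  \<comment> \<open>Both parts of \<open>?g\<close> give the inner product of \<open>h\<close> with
    \<open>bv * u\<close>: the first since \<open>bv * u\<close> is in \<open>H2_circle\<close>, the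
    second since multiplication by \<open>bv\<close> preserves inner products.\<close>
  have "l2_inner ?g (\<lambda>t. bv t * u t) = 0" if u: "u \<in> H2_circle" for u
    using p'[OF bv_mult_H2[OF u]] q'[OF u]
    by (simp add: l2_inner_diff_left L2 H2_circle_L2[OF u] l2_inner_bv_bv L2_circleD)
  then have "?g \<in> model_space \<Theta>" using gH by (simp add: model_space_def)
  \<comment> \<open>Here \<open>h - p\<close> is orthogonal to all of \<open>H2_circle\<close>, and
    \<open>bv * q\<close> is orthogonal to \<open>f\<close> by the definition of the model
    space.\<close>
  moreover have "l2_inner (\<lambda>t. h t - ?g t) f = 0" if f: "f \<in> model_space \<Theta>" for f
  proof -
    have fH: "f \<in> H2_circle" using f by (simp add: model_space_def)
    have "l2_inner f (\<lambda>t. bv t * q t) = 0" using f q(1) by (simp add: model_space_def)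
    then have "l2_inner (\<lambda>t. bv t * q t) f = 0" by (subst l2_inner_commute) simp
    then show ?thesis
      by (simp add: l2_inner_diff_left L2 H2_circle_L2[OF fH] p'[OF fH])
  qed
  ultimately show ?thesis by blast
qed

text \<open>The representative picked by \<open>SOME\<close> enters the final estimate only through
  its membership and its pairings with the model space.\<close>

lemma model_projection:
  assumes h: "h \<in> L2_circle"
  shows "model_projection \<Theta> h \<in> model_space \<Theta>"
    and "f \<in> model_space \<Theta> \<Longrightarrow> l2_inner (model_projection \<Theta> h) f = l2_inner h f"
proof -
  have *: "model_projection \<Theta> h \<in> model_space \<Theta> \<and>
      (\<forall>f\<in>model_space \<Theta>. l2_inner (\<lambda>t. h t - model_projection \<Theta> h t) f = 0)"
    unfolding model_projection_def by (rule someI_ex[OF model_projection_exists[OF h]])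
  then show "model_projection \<Theta> h \<in> model_space \<Theta>" ..
  show "l2_inner (model_projection \<Theta> h) f = l2_inner h f" if f: "f \<in> model_space \<Theta>"
  proof -
    have "l2_inner h f - l2_inner (model_projection \<Theta> h) f = 0"
      using * f l2_inner_diff_left[OF h model_space_L2 model_space_L2[OF f], of "model_projection \<Theta> h"]
      by simp
    then show ?thesis by simp
  qed
qed

text \<open>Multiplication by \<open>bv\<close> is isometric, so Cauchy-Schwarz for
  \<open>bv * szego z\<close> against \<open>szego z\<close>, combined with the reproducing
  property, bounds \<open>cmod (\<Theta> z)\<close> by 1. Equality at one point would make
  \<open>\<Theta>\<close> constant by the maximum principle.\<close>

lemma cmod_less_1:
  assumes w: "cmod w < 1"
  shows "cmod (\<Theta> w) < 1"
proof -
  have le: "cmod (\<Theta> z) \<le> 1" if z: "cmod z < 1" for z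
  proof -
    have s: "szego z \<in> H2_circle" "szego z \<in> L2_circle" using szego_H2[OF z] szego_L2[OF z] by auto
    have lim: "AE t in circle_measure. nt_limit (\<lambda>x. \<Theta> x * szego z x) t (bv t * szego z t)"
      using AE_bv szego_nt_limit[OF z] by eventually_elim (auto intro: nt_limit_mult)
    have "l2_inner (\<lambda>t. bv t * szego z t) (szego z) = \<Theta> z * szego z z"
      by (rule szego_reproducing[OF z bv_mult_L2[OF s(2)] H2_discI_bounded_mult[OF Hinf
            h2_series_in_H2[OF szego_series[OF z]]] lim])
    moreover have ss: "l2_inner (szego z) (szego z) = szego z z"
      by (rule szego_reproducing[OF z s(2) h2_series_in_H2[OF szego_series[OF z]] szego_nt_limit[OF z]])
    moreover have "(l2_norm (\<lambda>t. bv t * szego z t))\<^sup>2 = (l2_norm (szego z))\<^sup>2"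
      using l2_inner_bv_bv[of "szego z" "szego z"] L2_circleD[OF s(2)]
      unfolding l2_inner_self of_real_eq_iff by simp
    then have "l2_norm (\<lambda>t. bv t * szego z t) = l2_norm (szego z)" by simp
    ultimately have "cmod (\<Theta> z) * cmod (szego z z) \<le> (l2_norm (szego z))\<^sup>2"
      using l2_inner_norm_le[OF bv_mult_L2[OF s(2)] s(2)] by (simp add: norm_mult power2_eq_square)
    moreover have "cmod (szego z z) = (l2_norm (szego z))\<^sup>2"
      using ss unfolding l2_inner_self by (metis abs_of_nonneg norm_of_real zero_le_power2)
    moreover have "szego z z \<noteq> 0"
      using one_minus_mult_nonzero[of "cnj z" z] z by (simp add: szego_def)
    ultimately show ?thesis
      by (cases "l2_norm (szego z) = 0") (auto simp: mult_le_cancel_right2)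
  qed
  have "cmod (\<Theta> w) \<noteq> 1"
  proof
    assume "cmod (\<Theta> w) = 1"
    then have "\<Theta> constant_on ball 0 1"
      using w le by (intro maximum_modulus_principle[OF holomorphic _ _ _ order_refl, of w]) auto
    then show False using nonconst by contradiction
  qed
  then show ?thesis using le[OF w] by simp
qed

section \<open>Reproducing kernels of the model space\<close>

definition kernel :: "complex \<Rightarrow> complex \<Rightarrow> complex" where
  "kernel w t = (1 - cnj (\<Theta> w) * bv t) * szego w t"

context
  fixes w assumes w: "cmod w < 1"
begin

text \<open>The analytic function whose boundary values form \<open>kernel w\<close>.\<close>

definition kernel_disc :: "complex \<Rightarrow> complex" where
  "kernel_disc z = (1 - cnj (\<Theta> w) * \<Theta> z) * szego w z"

lemma kernel_nt_limit: "AE t in circle_measure. nt_limit kernel_disc t (kernel w t)"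
  using AE_bv szego_nt_limit[OF w] unfolding kernel_def[abs_def] kernel_disc_def[abs_def]
  by eventually_elim (intro nt_limit_mult nt_limit_diff nt_limit_const, auto)

lemma szego_bounded: "bounded (szego w ` ball 0 1)"
proof -
  have "compact (szego w ` cball 0 1)"
    by (intro compact_continuous_image szego_continuous_on w) simp
  then show ?thesis by (rule bounded_subset[OF compact_imp_bounded]) auto
qed

lemma kernel_disc_Hinf: "kernel_disc \<in> Hinf_disc"
proof -
  obtain B where B: "\<forall>z\<in>ball 0 1. cmod (szego w z) \<le> B"
    using szego_bounded by (auto simp: bounded_iff)
  have "cmod (kernel_disc z) \<le> 2 * B" if z: "cmod z < 1" for z
  proof -
    have "cmod (1 - cnj (\<Theta> w) * \<Theta> z) \<le> 1 + cmod (\<Theta> w) * cmod (\<Theta> z)"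
      using norm_triangle_ineq4[of 1 "cnj (\<Theta> w) * \<Theta> z"] by (simp add: norm_mult)
    also have "\<dots> \<le> 2"
      using mult_mono[of "cmod (\<Theta> w)" 1 "cmod (\<Theta> z)" 1] cmod_less_1[OF w] cmod_less_1[OF z] by simp
    finally show ?thesis
      using B z unfolding kernel_disc_def norm_mult by (intro mult_mono) auto
  qed
  moreover have "kernel_disc holomorphic_on ball 0 1"
    unfolding kernel_disc_def[abs_def] by (intro holomorphic_intros holomorphic szego_holomorphic w)
  ultimately show ?thesis by (auto simp: Hinf_disc_def bounded_iff intro!: exI[of _ "2 * B"])
qed

lemma kernel_eq: "kernel w t = szego w t - cnj (\<Theta> w) * (bv t * szego w t)"
  by (simp add: kernel_def algebra_simps)

lemma kernel_L2: "kernel w \<in> L2_circle"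
  unfolding kernel_eq[abs_def] by (intro L2_circle_diff L2_circle_mult bv_mult_L2 szego_L2 w)

text \<open>By the reproducing property \<open>bv * g\<close> pairs to
  \<open>\<Theta> w * G w\<close> with \<open>szego w\<close> and to \<open>G w\<close> with
  \<open>bv * szego w\<close>; the factor \<open>cnj (\<Theta> w)\<close> in the kernel makes the
  two contributions cancel.\<close>

lemma kernel_in_model_space: "kernel w \<in> model_space \<Theta>"
  unfolding model_space_def
proof (intro CollectI conjI ballI)
  show "kernel w \<in> H2_circle"
    unfolding H2_circle_def using kernel_L2 Hinf_disc_H2_disc[OF kernel_disc_Hinf] kernel_nt_limit by blast
  fix g assume g: "g \<in> H2_circle"
  then obtain G where G: "G \<in> H2_disc" "AE t in circle_measure. nt_limit G t (g t)"
    by (auto simp: H2_circle_def)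
  note L2 = H2_circle_L2[OF g] szego_L2[OF w] bv_mult_L2 L2_circle_mult
  have lim: "AE t in circle_measure. nt_limit (\<lambda>z. \<Theta> z * G z) t (bv t * g t)"
    using AE_bv G(2) by eventually_elim (auto intro: nt_limit_mult)
  have "l2_inner (\<lambda>t. bv t * g t) (kernel w) =
      l2_inner (\<lambda>t. bv t * g t) (szego w) - \<Theta> w * l2_inner (\<lambda>t. bv t * g t) (\<lambda>t. bv t * szego w t)"
    unfolding kernel_eq[abs_def] by (simp add: l2_inner_diff_right l2_inner_mult_right L2)
  also have "l2_inner (\<lambda>t. bv t * g t) (\<lambda>t. bv t * szego w t) = G w"
    by (simp add: l2_inner_bv_bv L2 L2_circleD szego_reproducing[OF w _ G])
  also have "l2_inner (\<lambda>t. bv t * g t) (szego w) = \<Theta> w * G w"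
    by (rule szego_reproducing[OF w _ H2_discI_bounded_mult[OF Hinf G(1)] lim]) (simp add: L2)
  finally have "l2_inner (\<lambda>t. bv t * g t) (kernel w) = 0" by simp
  then show "l2_inner (kernel w) (\<lambda>t. bv t * g t) = 0" by (subst l2_inner_commute) simp
qed

lemma kernel_in_model_space_inf: "kernel w \<in> model_space_inf \<Theta>"
  unfolding model_space_inf_def Hinf_circle_def
  using kernel_in_model_space kernel_L2 kernel_disc_Hinf kernel_nt_limit by blast

text \<open>The kernel is orthogonal to its own summand in \<open>\<Theta>\<close> times the Hardy
  space, so pairing it with itself amounts to pairing it with \<open>szego w\<close>, which
  evaluates \<open>kernel_disc\<close> at \<open>w\<close>.\<close>

lemma kernel_norm: "(l2_norm (kernel w))\<^sup>2 = (1 - (cmod (\<Theta> w))\<^sup>2) / (1 - (cmod w)\<^sup>2)"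
proof -
  have "l2_inner (kernel w) (\<lambda>t. bv t * szego w t) = 0"
    using kernel_in_model_space szego_H2[OF w] by (simp add: model_space_def)
  then have "l2_inner (kernel w) (kernel w) = l2_inner (kernel w) (szego w)"
    by (subst (2) kernel_eq[abs_def])
       (simp add: l2_inner_diff_right l2_inner_mult_right kernel_L2 szego_L2 w bv_mult_L2 L2_circle_mult)
  also have "\<dots> = kernel_disc w"
    by (rule szego_reproducing[OF w kernel_L2 Hinf_disc_H2_disc[OF kernel_disc_Hinf] kernel_nt_limit])
  also have "\<dots> = of_real ((1 - (cmod (\<Theta> w))\<^sup>2) / (1 - (cmod w)\<^sup>2))"
    by (simp add: kernel_disc_def szego_def complex_norm_square mult.commute del: of_real_power)
  finally show ?thesis unfolding l2_inner_self of_real_eq_iff .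
qed

section \<open>The measures \<open>nu_measure\<close> in terms of the kernels\<close>

lemma AE_kernel:
  "AE t in circle_measure. cmod ((bv t - \<Theta> w) / (t - w)) = cmod (kernel w t)"
  using AE_cmod_bv AE_circle_norm
proof eventually_elim
  case (elim t)
  \<comment> \<open>Applied with \<open>s = bv t\<close> to the numerator and with
    \<open>s = t\<close> to the denominator.\<close>
  have *: "cmod (1 - cnj u * s) = cmod (s - u)" if "cmod s = 1" for u s
  proof -
    have "s * cnj s = 1" using that by (simp add: complex_norm_square[symmetric])
    then have "1 - cnj u * s = s * cnj (s - u)" by (simp add: algebra_simps)
    then show ?thesis using that by (simp add: norm_mult flip: complex_cnj_diff)
  qed
  show ?case
    using *[OF elim(1), of "\<Theta> w"] *[OF elim(2), of w]
    by (simp add: kernel_def szego_def norm_divide)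
qed

text \<open>The reciprocal of the squared norm of \<open>kernel w\<close>.\<close>

definition density_factor :: real where
  "density_factor = (1 - (cmod w)\<^sup>2) / (1 - (cmod (\<Theta> w))\<^sup>2)"

lemma density_factor_pos: "density_factor > 0"
  unfolding density_factor_def using w cmod_less_1[OF w]
  by (intro divide_pos_pos) (simp_all add: abs_square_less_1)

lemma density_factor_kernel_norm: "density_factor * (l2_norm (kernel w))\<^sup>2 = 1"
proof -
  have "(cmod w)\<^sup>2 < 1" "(cmod (\<Theta> w))\<^sup>2 < 1"
    using w cmod_less_1[OF w] by (simp_all add: abs_square_less_1)
  then show ?thesis unfolding kernel_norm density_factor_def by simp
qed

abbreviation "weight t \<equiv> (cmod ((bv t - \<Theta> w) / (t - w)))\<^sup>2"

lemma weight_measurable [measurable]: "(\<lambda>t. weight t) \<in> borel_measurable circle_measure"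
  by measurable

lemma AE_weight: "AE t in circle_measure. weight t = (cmod (kernel w t))\<^sup>2"
  using AE_kernel by eventually_elim simp

lemma nu_measure_eq: "nu_measure \<Theta> w = density circle_measure (\<lambda>t. ennreal (density_factor * weight t))"
  by (simp add: nu_measure_def density_factor_def)

lemma prob_space_nu_measure: "prob_space (nu_measure \<Theta> w)"
proof
  note [measurable] = L2_circleD[OF kernel_L2]
  have "emeasure (nu_measure \<Theta> w) (space (nu_measure \<Theta> w)) =
      (\<integral>\<^sup>+t. ennreal (density_factor * weight t) * indicator (space circle_measure) t \<partial>circle_measure)"
    unfolding nu_measure_eq space_density by (rule emeasure_density) (auto simp del: space_circle_measure)
  also have "\<dots> = (\<integral>\<^sup>+t. ennreal (density_factor * (cmod (kernel w t))\<^sup>2) \<partial>circle_measure)"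
  proof (rule nn_integral_cong_AE)
    show "AE t in circle_measure. ennreal (density_factor * weight t) * indicator (space circle_measure) t =
        ennreal (density_factor * (cmod (kernel w t))\<^sup>2)"
      using AE_weight AE_space[of circle_measure]
      by eventually_elim (simp only: indicator_simps mult_1_right)
  qed
  also have "\<dots> = ennreal (\<integral>t. density_factor * (cmod (kernel w t))\<^sup>2 \<partial>circle_measure)"
    using density_factor_pos
    by (intro nn_integral_eq_integral integrable_mult_right L2_circle_integrable_sq kernel_L2) auto
  also have "\<dots> = 1"
    using density_factor_kernel_norm by (simp add: l2_norm_sq)
  finally show "emeasure (nu_measure \<Theta> w) (space (nu_measure \<Theta> w)) = 1" .
qed

lemma integral_nu_measure:
  assumes [measurable]: "\<phi> \<in> borel_measurable circle_measure"
  shows "cmod (\<integral>t. \<phi> t \<partial>nu_measure \<Theta> w) =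
    density_factor * cmod (\<integral>t. \<phi> t * of_real (weight t) \<partial>circle_measure)"
proof -
  have "(\<integral>t. \<phi> t \<partial>nu_measure \<Theta> w) = (\<integral>t. (density_factor * weight t) *\<^sub>R \<phi> t \<partial>circle_measure)"
    unfolding nu_measure_eq using density_factor_pos
    by (intro integral_density) (auto intro!: AE_I2)
  also have "\<dots> = (\<integral>t. of_real density_factor * (\<phi> t * of_real (weight t)) \<partial>circle_measure)"
    by (intro Bochner_Integration.integral_cong) (auto simp: scaleR_conv_of_real mult_ac)
  also have "\<dots> = of_real density_factor * (\<integral>t. \<phi> t * of_real (weight t) \<partial>circle_measure)"
    by (rule integral_mult_right_zero)
  finally show ?thesis using density_factor_pos by (simp add: norm_mult)
qed

lemma integral_weight_le_norm:
  assumes \<phi>: "\<phi> \<in> L2_circle"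
  shows "ennreal (density_factor * cmod (\<integral>t. \<phi> t * of_real (weight t) \<partial>circle_measure))
    \<le> truncated_toeplitz_norm \<Theta> \<phi>"
proof -
  note [measurable] = L2_circleD[OF kernel_L2] L2_circleD[OF \<phi>] L2_circleD[OF L2_circle_cnj[OF kernel_L2]]
  \<comment> \<open>The square root of \<open>density_factor\<close> is the reciprocal of the norm
    of \<open>kernel w\<close>, so \<open>?f\<close> is the normalised kernel and is admissible in
    the supremum.\<close>
  let ?c = "complex_of_real (sqrt density_factor)"
  let ?f = "\<lambda>t. ?c * kernel w t"
  have c: "?c * ?c = of_real density_factor"
    using density_factor_pos by (simp flip: of_real_mult)
  have fK: "?f \<in> model_space_inf \<Theta>" by (rule model_space_inf_mult[OF kernel_in_model_space_inf])
  then have fm: "?f \<in> model_space \<Theta>" by (simp add: model_space_inf_def)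
  have fL: "?f \<in> L2_circle" by (rule L2_circle_mult[OF kernel_L2])
  have "(l2_norm ?f)\<^sup>2 = density_factor * (l2_norm (kernel w))\<^sup>2"
    unfolding l2_norm_sq using density_factor_pos by (simp add: norm_mult power_mult_distrib)
  then have f1: "l2_norm ?f = 1"
    using density_factor_kernel_norm l2_norm_nonneg[of ?f] by (simp add: power2_eq_1_iff)
  have \<phi>f: "(\<lambda>t. \<phi> t * ?f t) \<in> L2_circle"
    by (rule L2_circle_mult_Hinf[OF \<phi> fK])
  let ?A = "truncated_toeplitz \<Theta> \<phi> ?f"
  have "of_real density_factor * (\<integral>t. \<phi> t * of_real (weight t) \<partial>circle_measure) =
      of_real density_factor * (\<integral>t. \<phi> t * (kernel w t * cnj (kernel w t)) \<partial>circle_measure)"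
  proof (rule arg_cong[where f = "\<lambda>x. _ * x"], rule integral_cong_AE)
    show "AE t in circle_measure. \<phi> t * of_real (weight t) = \<phi> t * (kernel w t * cnj (kernel w t))"
      using AE_weight by eventually_elim (simp only: complex_norm_square)
  qed measurable
  also have "\<dots> = l2_inner (\<lambda>t. \<phi> t * ?f t) ?f"
    unfolding l2_inner_def c[symmetric]
    by (subst integral_mult_right_zero[symmetric]) (simp add: mult_ac)
  \<comment> \<open>Since \<open>?f\<close> lies in the model space, projecting the left argument
    does not change the inner product.\<close>
  also have "\<dots> = l2_inner ?A ?f"
    unfolding truncated_toeplitz_def using model_projection(2)[OF \<phi>f fm] by simp
  finally have eq: "of_real density_factor * (\<integral>t. \<phi> t * of_real (weight t) \<partial>circle_measure) =
      l2_inner ?A ?f" .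
  have "density_factor * cmod (\<integral>t. \<phi> t * of_real (weight t) \<partial>circle_measure) =
      cmod (of_real density_factor * (\<integral>t. \<phi> t * of_real (weight t) \<partial>circle_measure))"
    unfolding norm_mult norm_of_real abs_of_pos[OF density_factor_pos] ..
  also have "\<dots> = cmod (l2_inner ?A ?f)" unfolding eq ..
  also have "\<dots> \<le> l2_norm ?A * l2_norm ?f"
    unfolding truncated_toeplitz_def
    by (rule l2_inner_norm_le[OF model_space_L2[OF model_projection(1)[OF \<phi>f]] fL])
  finally have "density_factor * cmod (\<integral>t. \<phi> t * of_real (weight t) \<partial>circle_measure) \<le> l2_norm ?A"
    by (simp add: f1)
  then have "ennreal (density_factor * cmod (\<integral>t. \<phi> t * of_real (weight t) \<partial>circle_measure)) \<le> ennreal (l2_norm ?A)"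
    by (rule ennreal_leI)
  also have "\<dots> \<le> truncated_toeplitz_norm \<Theta> \<phi>"
    unfolding truncated_toeplitz_norm_def using fK f1 by (intro SUP_upper) simp
  finally show ?thesis .
qed

end

end

theorem theorem1:
  fixes \<Theta> \<phi> :: "complex \<Rightarrow> complex"
  assumes "inner_function \<Theta>"
    and "\<not> \<Theta> constant_on ball 0 1"
    and "\<phi> \<in> L2_circle"
  shows "(\<forall>w \<in> ball 0 1. prob_space (nu_measure \<Theta> w)) \<and>
    (SUP w \<in> ball 0 1. ennreal (cmod (\<integral>z. \<phi> z \<partial>nu_measure \<Theta> w))) =
      (SUP w \<in> ball 0 1. ennreal ((1 - (cmod w)\<^sup>2) / (1 - (cmod (\<Theta> w))\<^sup>2) *
         cmod (\<integral>z. \<phi> z * of_real ((cmod ((boundary_value \<Theta> z - \<Theta> w) / (z - w)))\<^sup>2)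
           \<partial>circle_measure))) \<and>
    (SUP w \<in> ball 0 1. ennreal ((1 - (cmod w)\<^sup>2) / (1 - (cmod (\<Theta> w))\<^sup>2) *
       cmod (\<integral>z. \<phi> z * of_real ((cmod ((boundary_value \<Theta> z - \<Theta> w) / (z - w)))\<^sup>2)
         \<partial>circle_measure)))
      \<le> truncated_toeplitz_norm \<Theta> \<phi>"
proof -
  interpret inner_fun \<Theta> using assms by unfold_locales
  note \<phi> = assms(3)
  have "prob_space (nu_measure \<Theta> w)" if "w \<in> ball 0 1" for w
    using that by (intro prob_space_nu_measure) simp
  moreover have "cmod (\<integral>z. \<phi> z \<partial>nu_measure \<Theta> w) = (1 - (cmod w)\<^sup>2) / (1 - (cmod (\<Theta> w))\<^sup>2) *
      cmod (\<integral>z. \<phi> z * of_real ((cmod ((bv z - \<Theta> w) / (z - w)))\<^sup>2) \<partial>circle_measure)"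
    if "w \<in> ball 0 1" for w
    using that integral_nu_measure[of w \<phi>] L2_circleD[OF \<phi>] by (simp add: density_factor_def)
  moreover have "ennreal ((1 - (cmod w)\<^sup>2) / (1 - (cmod (\<Theta> w))\<^sup>2) *
      cmod (\<integral>z. \<phi> z * of_real ((cmod ((bv z - \<Theta> w) / (z - w)))\<^sup>2) \<partial>circle_measure))
      \<le> truncated_toeplitz_norm \<Theta> \<phi>" if "w \<in> ball 0 1" for w
    using that integral_weight_le_norm[of w \<phi>] \<phi> by (simp add: density_factor_def)
  ultimately show ?thesis
    by (intro conjI ballI SUP_cong SUP_least refl) simp_all
qed

end
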